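(* Let $K$ be a commutative ring with identity and $n\ge1$. The inter-degree multiplication $\boxtimes$ on $\mathrm{Schur}(n,K)=\bigoplus_{q\ge0}\mathrm{Schur}(q,n,K)$ is associative and commutative and satisfies the distributive laws; thus $(\mathrm{Schur}(n,K),+,\boxtimes)$ is an associative and anti-commutative graded $K$-algebra.
   Context: Let $V_n$ be the free $K$-module on $x_1,\dots,x_n$. $\Sigma_q$ acts on $V_n^{\otimes q}$ by $\sigma(y_1\otimes\cdots\otimes y_q)=y_{\sigma^{-1}(1)}\otimes\cdots\otimes y_{\sigma^{-1}(q)}$. $\mathrm{Schur}(q,n,K)$ is the $K$-module of $K$-linear endomorphisms of $V_n^{\otimes q}$ commuting with $\Sigma_q$; $\mathrm{Schur}(0,n,K)=K$. The product $\boxtimes:\mathrm{Schur}(a,n,K)\times\mathrm{Schur}(b,n,K)\to\mathrm{Schur}(a+b,n,K)$ is, for $a,b\ge1$, $$(f\boxtimes g)(w)=\sum_{\sigma\in L}\sigma\big((f\otimes g)(\sigma^{-1}(w))\big),\quad w\in V_n^{\otimes(a+b)},$$ with $L$ any complete set of representatives of the left cosets of $\Sigma_a\times\Sigma_b$ in $\Sigma_{a+b}$ (independent of the choice). If $a=0$ or $b=0$ it is scalar multiplication. It is extended bilinearly to the direct sum. Degrees are doubled: tensors in $V_n^{\otimes q}$, and elements of $\mathrm{Schur}(q,n,K)$, have degree $2q$. "Anti-commutative" means graded commutative, $a\boxtimes b=(-1)^{|a||b|}b\boxtimes a$ for homogeneous $a,b$ (all degrees being even). *)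

theory Defs
  imports
    "HOL-Library.FuncSet"
    "HOL-Library.Function_Algebras"
    "HOL-Algebra.Module"
    "HOL-Algebra.Sym_Groups"
    "HOL-Algebra.Left_Coset"
begin

text \<open>
  The sort \<open>{comm_ring, comm_monoid_mult}\<close> is used for the ground ring instead of
  \<open>comm_ring_1\<close>, because the latter requires \<open>0 \<noteq> 1\<close> and so excludes the zero ring.
\<close>

section \<open>Tensor powers of a free module\<close>

text \<open>
  Elements of \<open>V\<^sub>n\<close> are given by their coordinates with respect to \<open>x\<^sub>1, \<dots>, x\<^sub>n\<close>, the generator \<open>x\<^sub>i\<close>
  being \<open>gen i\<close>. The \<open>q\<close>-th tensor power of \<open>V\<^sub>n\<close> is free on the
  tensors \<open>x\<^bsub>w 1\<^esub> \<otimes> \<dots> \<otimes> x\<^bsub>w q\<^esub>\<close>, where \<open>w\<close> ranges over the words of length \<open>q\<close> in \<open>{1..n}\<close>; a tensor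
  is represented by its coordinate function with respect to this basis, extended by zero.
\<close>

type_synonym 'k tensor = "(nat \<Rightarrow> nat) \<Rightarrow> 'k"

definition gen :: "nat \<Rightarrow> nat \<Rightarrow> 'k::{comm_ring, comm_monoid_mult}" where
  "gen i = (\<lambda>j. if j = i then 1 else 0)"

definition words :: "nat \<Rightarrow> nat \<Rightarrow> (nat \<Rightarrow> nat) set" where
  "words n q = {1..q} \<rightarrow>\<^sub>E {1..n}"

definition tensors :: "nat \<Rightarrow> nat \<Rightarrow> 'k::{comm_ring, comm_monoid_mult} tensor set" where
  "tensors n q = {t. \<forall>w. w \<notin> words n q \<longrightarrow> t w = 0}"

text \<open>The tensor \<open>y 1 \<otimes> \<dots> \<otimes> y q\<close>.\<close>

definition pure_tensor ::
    "nat \<Rightarrow> nat \<Rightarrow> (nat \<Rightarrow> nat \<Rightarrow> 'k) \<Rightarrow> 'k::{comm_ring, comm_monoid_mult} tensor" where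
  "pure_tensor n q y = (\<lambda>w. if w \<in> words n q then \<Prod>i\<in>{1..q}. y i (w i) else 0)"

definition basis_tensor :: "(nat \<Rightarrow> nat) \<Rightarrow> 'k::{comm_ring, comm_monoid_mult} tensor" where
  "basis_tensor u = (\<lambda>w. if w = u then 1 else 0)"

definition scale_tensor :: "'k \<Rightarrow> 'k tensor \<Rightarrow> 'k::{comm_ring, comm_monoid_mult} tensor" where
  "scale_tensor c t = (\<lambda>w. c * t w)"

lemma scale_tensor_apply: "scale_tensor c t w = c * t w"
  by (simp add: scale_tensor_def)

lemma finite_words: "finite (words n q)"
  unfolding words_def by (intro finite_PiE) auto

lemma basis_tensor_eq_pure_tensor:
  assumes "u \<in> words n q"
  shows "basis_tensor u = pure_tensor n q (\<lambda>i. gen (u i))"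
proof
  fix w
  show "basis_tensor u w = pure_tensor n q (\<lambda>i. gen (u i)) w"
  proof (cases "w = u")
    case True
    then show ?thesis using assms by (simp add: basis_tensor_def pure_tensor_def gen_def)
  next
    case False
    have "(\<Prod>i\<in>{1..q}. gen (u i) (w i)) = 0" if w: "w \<in> words n q"
    proof -
      obtain i where i: "i \<in> {1..q}" "w i \<noteq> u i"
        using False w assms unfolding words_def by (metis PiE_ext)
      have "(\<Prod>i\<in>{1..q}. gen (u i) (w i)) =
          gen (u i) (w i) * (\<Prod>i\<in>{1..q} - {i}. gen (u i) (w i))"
        using i by (intro prod.remove) auto
      then show ?thesis using i by (simp add: gen_def)
    qed
    then show ?thesis using False by (auto simp: basis_tensor_def pure_tensor_def)
  qed
qed

lemma sum_fun_apply: "(\<Sum>u\<in>A. F u) w = (\<Sum>u\<in>A. F u w)"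
  by (induction A rule: infinite_finite_induct) auto

lemma tensor_eq_sum_basis:
  assumes "t \<in> tensors n q"
  shows "t = (\<Sum>u\<in>words n q. scale_tensor (t u) (basis_tensor u))"
proof
  fix w
  have "(\<Sum>u\<in>words n q. scale_tensor (t u) (basis_tensor u)) w =
      (\<Sum>u\<in>words n q. if w = u then t u else 0)"
    unfolding sum_fun_apply by (intro sum.cong) (auto simp: scale_tensor_def basis_tensor_def)
  also have "\<dots> = t w"
    using assms by (auto simp: finite_words tensors_def)
  finally show "t w = (\<Sum>u\<in>words n q. scale_tensor (t u) (basis_tensor u)) w" by simp
qed

text \<open>The action of \<open>\<Sigma>\<^sub>q\<close>; see \<open>permute_pure_tensor\<close> below.\<close>

definition permute_tensor ::
    "(nat \<Rightarrow> nat) \<Rightarrow> 'k tensor \<Rightarrow> 'k::{comm_ring, comm_monoid_mult} tensor" where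
  "permute_tensor \<sigma> t = (\<lambda>w. t (w \<circ> \<sigma>))"

lemma comp_permutes_words_iff:
  assumes "\<sigma> permutes {1..q}"
  shows "w \<circ> \<sigma> \<in> words n q \<longleftrightarrow> w \<in> words n q"
proof -
  have *: "v \<circ> \<tau> \<in> words n q" if "v \<in> words n q" "\<tau> permutes {1..q}" for v \<tau>
    using that permutes_in_image[OF that(2)] permutes_not_in[OF that(2)]
    unfolding words_def PiE_def Pi_def extensional_def by (auto simp del: atLeastAtMost_iff)
  have "w = w \<circ> \<sigma> \<circ> inv' \<sigma>"
    using permutes_inv_o(1)[OF assms] by (simp add: comp_assoc)
  then show ?thesis using *[OF _ permutes_inv[OF assms]] *[OF _ assms] by metis
qed

lemma permute_pure_tensor:
  assumes "\<sigma> permutes {1..q}"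
  shows "permute_tensor \<sigma> (pure_tensor n q y) = pure_tensor n q (\<lambda>i. y (inv' \<sigma> i))"
proof
  fix w
  have "(\<Prod>i\<in>{1..q}. y (inv' \<sigma> i) (w i)) = (\<Prod>i\<in>{1..q}. y i (w (\<sigma> i)))"
    using prod.permute[OF assms, of "\<lambda>i. y (inv' \<sigma> i) (w i)"]
      permutes_inverses(2)[OF assms] by (simp add: comp_def)
  then show "permute_tensor \<sigma> (pure_tensor n q y) w = pure_tensor n q (\<lambda>i. y (inv' \<sigma> i)) w"
    by (simp add: permute_tensor_def pure_tensor_def comp_permutes_words_iff[OF assms])
qed

text \<open>The identification of \<open>V\<^sub>n\<^bsup>\<otimes>a\<^esup> \<otimes> V\<^sub>n\<^bsup>\<otimes>b\<^esup>\<close> with \<open>V\<^sub>n\<^bsup>\<otimes>(a+b)\<^esup>\<close>.\<close>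

definition first_part :: "nat \<Rightarrow> (nat \<Rightarrow> nat) \<Rightarrow> nat \<Rightarrow> nat" where
  "first_part a w = restrict w {1..a}"

definition last_part :: "nat \<Rightarrow> nat \<Rightarrow> (nat \<Rightarrow> nat) \<Rightarrow> nat \<Rightarrow> nat" where
  "last_part a b w = restrict (\<lambda>j. w (a + j)) {1..b}"

definition join_words :: "nat \<Rightarrow> nat \<Rightarrow> (nat \<Rightarrow> nat) \<Rightarrow> (nat \<Rightarrow> nat) \<Rightarrow> nat \<Rightarrow> nat" where
  "join_words a b u v = restrict (\<lambda>i. if i \<le> a then u i else v (i - a)) {1..a + b}"

definition tensor_mult ::
    "nat \<Rightarrow> nat \<Rightarrow> nat \<Rightarrow> 'k tensor \<Rightarrow> 'k tensor \<Rightarrow> 'k::{comm_ring, comm_monoid_mult} tensor" where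
  "tensor_mult n a b s t =
    (\<lambda>w. if w \<in> words n (a + b) then s (first_part a w) * t (last_part a b w) else 0)"

lemma first_part_in_words: "w \<in> words n (a + b) \<Longrightarrow> first_part a w \<in> words n a"
  by (auto simp: words_def first_part_def PiE_iff)

lemma last_part_in_words: "w \<in> words n (a + b) \<Longrightarrow> last_part a b w \<in> words n b"
  by (auto simp: words_def last_part_def PiE_iff)

lemma tensor_mult_pure_tensor:
  "tensor_mult n a b (pure_tensor n a y) (pure_tensor n b z) =
    pure_tensor n (a + b) (\<lambda>i. if i \<le> a then y i else z (i - a))"
proof
  fix w
  show "tensor_mult n a b (pure_tensor n a y) (pure_tensor n b z) w =
    pure_tensor n (a + b) (\<lambda>i. if i \<le> a then y i else z (i - a)) w"
  proof (cases "w \<in> words n (a + b)")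
    case True
    let ?F = "\<lambda>i. (if i \<le> a then y i else z (i - a)) (w i)"
    have "{1..a + b} = {1..a} \<union> {a + 1..a + b}" by auto
    then have "prod ?F {1..a + b} = prod ?F {1..a} * prod ?F {a + 1..a + b}"
      by (simp add: prod.union_disjoint)
    also have "prod ?F {a + 1..a + b} = (\<Prod>j\<in>{1..b}. ?F (a + j))"
      by (rule prod.reindex_bij_witness[of _ "\<lambda>j. a + j" "\<lambda>i. i - a"]) auto
    finally show ?thesis
      using True first_part_in_words[OF True] last_part_in_words[OF True]
      by (simp add: tensor_mult_def pure_tensor_def first_part_def last_part_def)
  qed (simp add: tensor_mult_def pure_tensor_def)
qed


section \<open>Schur algebras\<close>

type_synonym 'k endo = "'k tensor \<Rightarrow> 'k tensor"

text \<open>Maps defined on \<open>tensors n q\<close> are extended by zero, so that \<open>+\<close> and \<open>=\<close> are pointwise.\<close>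

definition endos :: "nat \<Rightarrow> nat \<Rightarrow> 'k::{comm_ring, comm_monoid_mult} endo set" where
  "endos n q = {f.
    (\<forall>t\<in>tensors n q. f t \<in> tensors n q) \<and>
    (\<forall>s\<in>tensors n q. \<forall>t\<in>tensors n q. f (s + t) = f s + f t) \<and>
    (\<forall>c. \<forall>t\<in>tensors n q. f (scale_tensor c t) = scale_tensor c (f t)) \<and>
    (\<forall>t. t \<notin> tensors n q \<longrightarrow> f t = 0)}"

definition scale_endo :: "'k \<Rightarrow> 'k endo \<Rightarrow> 'k::{comm_ring, comm_monoid_mult} endo" where
  "scale_endo c f = (\<lambda>t. scale_tensor c (f t))"

text \<open>
  \<open>Schur(0,n,K) = K\<close> is realised inside the same type as the other components, with \<open>c\<close>
  encoded as multiplication by \<open>c\<close> on \<open>V\<^sub>n\<^bsup>\<otimes>0\<^esup> = K\<close>.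
\<close>

definition scalar_endo :: "nat \<Rightarrow> 'k \<Rightarrow> 'k::{comm_ring, comm_monoid_mult} endo" where
  "scalar_endo n c = (\<lambda>t. if t \<in> tensors n 0 then scale_tensor c t else 0)"

lemma inj_scalar_endo: "inj (scalar_endo n :: 'k::{comm_ring, comm_monoid_mult} \<Rightarrow> _)"
proof
  fix c d :: 'k
  assume eq: "scalar_endo n c = scalar_endo n d"
  let ?e = "\<lambda>_. undefined :: nat"
  have "(basis_tensor ?e :: 'k tensor) \<in> tensors n 0"
    by (auto simp: tensors_def words_def basis_tensor_def)
  with fun_cong[OF fun_cong[OF eq, of "basis_tensor ?e"], of ?e] show "c = d"
    by (simp add: scalar_endo_def scale_tensor_def basis_tensor_def)
qed

definition schur :: "nat \<Rightarrow> nat \<Rightarrow> 'k::{comm_ring, comm_monoid_mult} endo set" where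
  "schur q n =
    (if q = 0 then range (scalar_endo n)
     else {f \<in> endos n q. \<forall>\<sigma>\<in>carrier (sym_group q). \<forall>t\<in>tensors n q.
             f (permute_tensor \<sigma> t) = permute_tensor \<sigma> (f t)})"

text \<open>\<open>f \<otimes> g\<close>, in coordinates; it is characterised by \<open>tensor_endo_tensor_mult\<close> below.\<close>

definition tensor_endo ::
    "nat \<Rightarrow> nat \<Rightarrow> nat \<Rightarrow> 'k endo \<Rightarrow> 'k endo \<Rightarrow> 'k::{comm_ring, comm_monoid_mult} endo" where
  "tensor_endo n a b f g = (\<lambda>t.
    \<Sum>u\<in>words n a. \<Sum>v\<in>words n b.
      scale_tensor (t (join_words a b u v))
        (tensor_mult n a b (f (basis_tensor u)) (g (basis_tensor v))))"

lemma endos_coords: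
  assumes f: "f \<in> endos n q" and t: "t \<in> tensors n q"
  shows "f t w = (\<Sum>u\<in>words n q. t u * f (basis_tensor u) w)"
proof -
  have zero: "(0 :: 'a tensor) \<in> tensors n q" by (simp add: tensors_def)
  have "f (0 + 0) = f 0 + f 0"
    using f zero unfolding endos_def by blast
  then have f0: "f 0 = 0" by simp
  have b: "scale_tensor c (basis_tensor u) \<in> tensors n q" if "u \<in> words n q" for u and c :: 'a
    using that by (auto simp: tensors_def scale_tensor_def basis_tensor_def)
  have b1: "(basis_tensor u :: 'a tensor) \<in> tensors n q" if "u \<in> words n q" for u
    using that by (auto simp: tensors_def basis_tensor_def)
  have *: "(\<Sum>u\<in>A. scale_tensor (t u) (basis_tensor u)) \<in> tensors n q \<and>
      f (\<Sum>u\<in>A. scale_tensor (t u) (basis_tensor u)) w = (\<Sum>u\<in>A. t u * f (basis_tensor u) w)"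
    if "finite A" "A \<subseteq> words n q" for A
    using that
  proof (induction A rule: finite_induct)
    case empty
    show ?case using zero f0 by (simp add: zero_fun_def)
  next
    case (insert x A)
    let ?S = "\<Sum>u\<in>A. scale_tensor (t u) (basis_tensor u)"
    let ?x = "scale_tensor (t x) (basis_tensor x)"
    have S: "?S \<in> tensors n q" "f ?S w = (\<Sum>u\<in>A. t u * f (basis_tensor u) w)"
      and x: "x \<in> words n q"
      using insert by auto
    have "?x + ?S \<in> tensors n q"
      using b[OF x, of "t x"] S(1) by (simp add: tensors_def)
    moreover have "f (?x + ?S) = f ?x + f ?S"
      using f b[OF x, of "t x"] S(1) unfolding endos_def by blast
    moreover have "f ?x = scale_tensor (t x) (f (basis_tensor x))"
      using f b1[OF x] unfolding endos_def by blast
    ultimately have xS: "?x + ?S \<in> tensors n q"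
        "f (?x + ?S) w = t x * f (basis_tensor x) w + (\<Sum>u\<in>A. t u * f (basis_tensor u) w)"
      using S(2) by (simp_all add: scale_tensor_apply)
    have eq: "(\<Sum>u\<in>insert x A. scale_tensor (t u) (basis_tensor u)) = ?x + ?S"
      using insert.hyps by (rule sum.insert)
    show ?case
      unfolding eq using xS insert.hyps by (simp del: plus_fun_apply)
  qed
  show ?thesis
    using conjunct2[OF *[OF finite_words subset_refl]]
    unfolding tensor_eq_sum_basis[OF t, symmetric] .
qed

lemma tensor_endo_tensor_mult:
  assumes f: "f \<in> endos n a" and g: "g \<in> endos n b"
    and s: "s \<in> tensors n a" and t: "t \<in> tensors n b"
  shows "tensor_endo n a b f g (tensor_mult n a b s t) = tensor_mult n a b (f s) (g t)"
proof
  fix w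
  have join: "tensor_mult n a b s t (join_words a b u v) = s u * t v"
    if u: "u \<in> words n a" and v: "v \<in> words n b" for u v
  proof -
    have "first_part a (join_words a b u v) = u"
      using u by (auto simp: first_part_def join_words_def words_def PiE_iff extensional_def)
    moreover have "last_part a b (join_words a b u v) = v"
      using v by (auto simp: last_part_def join_words_def words_def PiE_iff extensional_def)
    moreover have "join_words a b u v \<in> words n (a + b)"
    proof -
      have "u i \<in> {1..n}" if "i \<in> {1..a}" for i
        using u that unfolding words_def by (rule PiE_mem)
      moreover have "v (i - a) \<in> {1..n}" if "i \<in> {1..a + b}" "\<not> i \<le> a" for i
      proof -
        have "i - a \<in> {1..b}" using that by auto
        with v show ?thesis unfolding words_def by (rule PiE_mem)
      qed
      ultimately show ?thesis by (auto simp: join_words_def words_def)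
    qed
    ultimately show ?thesis by (simp add: tensor_mult_def)
  qed
  show "tensor_endo n a b f g (tensor_mult n a b s t) w = tensor_mult n a b (f s) (g t) w"
  proof (cases "w \<in> words n (a + b)")
    case True
    have "tensor_endo n a b f g (tensor_mult n a b s t) w =
        (\<Sum>u\<in>words n a. \<Sum>v\<in>words n b.
          s u * t v * (f (basis_tensor u) (first_part a w) * g (basis_tensor v) (last_part a b w)))"
      unfolding tensor_endo_def sum_fun_apply using True
      by (intro sum.cong refl) (simp add: scale_tensor_def join, simp add: tensor_mult_def)
    also have "\<dots> = (\<Sum>u\<in>words n a. s u * f (basis_tensor u) (first_part a w)) *
        (\<Sum>v\<in>words n b. t v * g (basis_tensor v) (last_part a b w))"
      by (simp add: sum_product mult_ac)
    also have "\<dots> = tensor_mult n a b (f s) (g t) w"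
      using True endos_coords[OF f s] endos_coords[OF g t] by (simp add: tensor_mult_def)
    finally show ?thesis .
  next
    case False
    then show ?thesis
      unfolding tensor_endo_def sum_fun_apply by (simp add: tensor_mult_def scale_tensor_def)
  qed
qed


section \<open>The inter-degree product\<close>

text \<open>\<open>\<Sigma>\<^sub>a \<times> \<Sigma>\<^sub>b\<close> as a subgroup of \<open>\<Sigma>\<^bsub>a+b\<^esub>\<close>.\<close>

definition young_subgroup :: "nat \<Rightarrow> nat \<Rightarrow> (nat \<Rightarrow> nat) set" where
  "young_subgroup a b = {\<rho> \<circ> \<tau> | \<rho> \<tau>. \<rho> permutes {1..a} \<and> \<tau> permutes {a + 1..a + b}}"

definition left_coset_reps :: "nat \<Rightarrow> nat \<Rightarrow> (nat \<Rightarrow> nat) set \<Rightarrow> bool" where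
  "left_coset_reps a b L \<longleftrightarrow>
    L \<subseteq> carrier (sym_group (a + b)) \<and>
    (\<forall>C \<in> lcosets\<^bsub>sym_group (a + b)\<^esub> (young_subgroup a b). \<exists>!\<sigma>. \<sigma> \<in> L \<inter> C)"

text \<open>In the following, \<open>L a b\<close> is the set of coset representatives used in bidegree \<open>(a, b)\<close>.\<close>

definition boxtimes ::
    "nat \<Rightarrow> (nat \<Rightarrow> nat \<Rightarrow> (nat \<Rightarrow> nat) set) \<Rightarrow> nat \<Rightarrow> nat \<Rightarrow>
      'k endo \<Rightarrow> 'k endo \<Rightarrow> 'k::{comm_ring, comm_monoid_mult} endo" where
  "boxtimes n L a b f g =
    (if a = 0 then scale_endo (the_inv (scalar_endo n) f) g
     else if b = 0 then scale_endo (the_inv (scalar_endo n) g) f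
     else (\<lambda>w. if w \<in> tensors n (a + b)
       then \<Sum>\<sigma>\<in>L a b. permute_tensor \<sigma> (tensor_endo n a b f g (permute_tensor (inv' \<sigma>) w))
       else 0))"


section \<open>The direct sum\<close>

definition base_ring :: "'k::{comm_ring, comm_monoid_mult} ring" where
  "base_ring = \<lparr>carrier = UNIV, monoid.mult = (*), one = 1, zero = 0, add = (+)\<rparr>"

definition schur_sum :: "nat \<Rightarrow> (nat \<Rightarrow> 'k::{comm_ring, comm_monoid_mult} endo) set" where
  "schur_sum n = {F. (\<forall>q. F q \<in> schur q n) \<and> finite {q. F q \<noteq> 0}}"

definition schur_algebra ::
    "nat \<Rightarrow> (nat \<Rightarrow> nat \<Rightarrow> (nat \<Rightarrow> nat) set) \<Rightarrow>
      ('k::{comm_ring, comm_monoid_mult}, nat \<Rightarrow> 'k endo) module" where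
  "schur_algebra n L = \<lparr>
    carrier = schur_sum n,
    monoid.mult = (\<lambda>F G q. \<Sum>a\<le>q. boxtimes n L a (q - a) (F a) (G (q - a))),
    one = (\<lambda>q. if q = 0 then scalar_endo n 1 else 0),
    zero = 0,
    add = (+),
    smult = (\<lambda>c F q. scale_endo c (F q))\<rparr>"

text \<open>The homogeneous part of degree \<open>d\<close>, where \<open>Schur(q,n,K)\<close> is placed in degree \<open>2q\<close>.\<close>

definition schur_degree :: "nat \<Rightarrow> nat \<Rightarrow> (nat \<Rightarrow> 'k::{comm_ring, comm_monoid_mult} endo) set" where
  "schur_degree n d = {F \<in> schur_sum n. \<forall>q. 2 * q \<noteq> d \<longrightarrow> F q = 0}"


section \<open>Graded algebras\<close>

definition graded_by :: "('k, 'm) ring_scheme \<Rightarrow> ('k, 'a, 'n) module_scheme \<Rightarrow> (nat \<Rightarrow> 'a set) \<Rightarrow> bool"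
  where "graded_by R M A \<longleftrightarrow>
    (\<forall>d. submodule (A d) R M) \<and>
    (\<forall>x\<in>carrier M. \<exists>!c. (\<forall>d. c d \<in> A d) \<and> finite {d. c d \<noteq> \<zero>\<^bsub>M\<^esub>} \<and>
       x = (\<Oplus>\<^bsub>M\<^esub>d\<in>{d. c d \<noteq> \<zero>\<^bsub>M\<^esub>}. c d)) \<and>
    \<one>\<^bsub>M\<^esub> \<in> A 0 \<and>
    (\<forall>d e. \<forall>x\<in>A d. \<forall>y\<in>A e. x \<otimes>\<^bsub>M\<^esub> y \<in> A (d + e))"

definition anti_commutative ::
    "('k, 'm) ring_scheme \<Rightarrow> ('k, 'a, 'n) module_scheme \<Rightarrow> (nat \<Rightarrow> 'a set) \<Rightarrow> bool"
  where "anti_commutative R M A \<longleftrightarrow>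
    (\<forall>d e. \<forall>x\<in>A d. \<forall>y\<in>A e.
      x \<otimes>\<^bsub>M\<^esub> y = ((\<ominus>\<^bsub>R\<^esub> \<one>\<^bsub>R\<^esub>) [^]\<^bsub>R\<^esub> (d * e)) \<odot>\<^bsub>M\<^esub> (y \<otimes>\<^bsub>M\<^esub> x))"

end

theory Submission
  imports Defs
begin

text \<open>
  By equivariance, the matrix coefficient of \<open>f \<in> Schur(q,n,K)\<close> at two words \<open>u\<close>, \<open>w\<close> indexed by a
  finite set \<open>A\<close> of size \<open>q\<close> does not depend on how \<open>A\<close> is ordered. A family \<open>F\<close> in the direct sum
  thus becomes, for fixed \<open>u\<close> and \<open>w\<close>, a function of finite sets, and \<open>F\<close> is determined by these
  functions. Since \<open>\<sigma> \<mapsto> \<sigma> ` {1..a}\<close> identifies the left cosets of \<open>\<Sigma>\<^sub>a \<times> \<Sigma>\<^sub>b\<close> with the \<open>a\<close>-element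
  subsets of \<open>{1..a + b}\<close>, the product becomes \<open>Z \<mapsto> \<Sum>A\<subseteq>Z. F A * G (Z - A)\<close>, for which the ring
  laws are evident.
\<close>

section \<open>Matrix coefficients of Schur algebra elements\<close>

lemma basis_tensor_in_tensors: "u \<in> words n q \<Longrightarrow> basis_tensor u \<in> tensors n q"
  by (auto simp: tensors_def basis_tensor_def)

lemma endos_eqI:
  assumes f: "f \<in> endos n q" and g: "g \<in> endos n q"
    and eq: "\<And>u w. u \<in> words n q \<Longrightarrow> w \<in> words n q \<Longrightarrow> f (basis_tensor u) w = g (basis_tensor u) w"
  shows "f = g"
proof
  fix t
  show "f t = g t"
  proof (cases "t \<in> tensors n q")
    case True
    show ?thesis
    proof
      fix w
      show "f t w = g t w"
      proof (cases "w \<in> words n q")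
        case w: True
        show ?thesis
          unfolding endos_coords[OF f True] endos_coords[OF g True] using eq w by simp
      next
        case False
        have "f t \<in> tensors n q" "g t \<in> tensors n q"
          using f g True by (auto simp: endos_def)
        then show ?thesis using False by (simp add: tensors_def)
      qed
    qed
  next
    case False
    then show ?thesis using f g by (simp add: endos_def)
  qed
qed

text \<open>\<open>permute_tensor\<close> precomposes the argument, so it moves the single nonzero
  coordinate the opposite way; this explains the inverse on the left.\<close>

lemma permute_basis_tensor:
  assumes "\<sigma> permutes {1..q}"
  shows "permute_tensor (inv' \<sigma>) (basis_tensor u) = basis_tensor (u \<circ> \<sigma>)"
proof -
  have "w \<circ> inv' \<sigma> = u \<longleftrightarrow> w = u \<circ> \<sigma>" for w
    using permutes_inv_o[OF assms] by (metis comp_assoc comp_id)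
  then show ?thesis by (simp add: permute_tensor_def basis_tensor_def fun_eq_iff)
qed

lemma permute_tensor_in_tensors:
  assumes "\<sigma> permutes {1..q}" "t \<in> tensors n q"
  shows "permute_tensor \<sigma> t \<in> tensors n q"
  using assms by (simp add: tensors_def permute_tensor_def comp_permutes_words_iff)

lemma tensors_add: "s \<in> tensors n q \<Longrightarrow> t \<in> tensors n q \<Longrightarrow> s + t \<in> tensors n q"
  by (simp add: tensors_def)

lemma tensors_scale: "t \<in> tensors n q \<Longrightarrow> scale_tensor c t \<in> tensors n q"
  by (simp add: tensors_def scale_tensor_def)

lemma endosD:
  assumes "f \<in> endos n q"
  shows "t \<in> tensors n q \<Longrightarrow> f t \<in> tensors n q"
    and "s \<in> tensors n q \<Longrightarrow> t \<in> tensors n q \<Longrightarrow> f (s + t) = f s + f t"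
    and "t \<in> tensors n q \<Longrightarrow> f (scale_tensor c t) = scale_tensor c (f t)"
    and "t \<notin> tensors n q \<Longrightarrow> f t = 0"
  using assms unfolding endos_def by blast+

lemma words_0: "words n 0 = {\<lambda>_. undefined}"
  by (simp add: words_def)

lemma scalar_endo_in_endos: "scalar_endo n c \<in> endos n 0"
  unfolding endos_def scalar_endo_def
  by (auto simp: tensors_add tensors_scale scale_tensor_def tensors_def fun_eq_iff distrib_left mult_ac)

text \<open>There is exactly one word of length 0, so an endomorphism in degree 0 is a 1-by-1
  matrix. This lets degree 0 follow the same description as the other degrees.\<close>

lemma endos_0: "endos n 0 = range (scalar_endo n)"
proof
  show "range (scalar_endo n) \<subseteq> (endos n 0 :: 'a endo set)"
    using scalar_endo_in_endos by blast
  show "endos n 0 \<subseteq> (range (scalar_endo n) :: 'a endo set)"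
  proof
    fix f :: "'a endo" assume f: "f \<in> endos n 0"
    \<comment> \<open>The unique word of length 0: an extensional function on the empty set is
      \<open>undefined\<close> everywhere.\<close>
    let ?e = "\<lambda>_::nat. undefined :: nat"
    have "f = scalar_endo n (f (basis_tensor ?e) ?e)"
    proof (rule endos_eqI[OF f scalar_endo_in_endos])
      fix u w :: "nat \<Rightarrow> nat" assume "u \<in> words n 0" "w \<in> words n 0"
      then show "f (basis_tensor u) w = scalar_endo n (f (basis_tensor ?e) ?e) (basis_tensor u) w"
        using basis_tensor_in_tensors[of u n 0, where 'a = 'a]
        by (simp add: words_0 scalar_endo_def scale_tensor_def) (simp add: basis_tensor_def)
    qed
    then show "f \<in> range (scalar_endo n)" by blast
  qed
qed

text \<open>By linearity, equivariance can be tested on basis tensors, where it says that the matrix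
  is constant on orbits of simultaneous permutations of the row and column words. For
  \<open>q = 0\<close> only the identity permutes the empty set, and \<open>endos_0\<close> gives
  the claim.\<close>

lemma schur_iff_coeff:
  "f \<in> schur q n \<longleftrightarrow> f \<in> endos n q \<and>
    (\<forall>\<sigma> u w. \<sigma> permutes {1..q} \<longrightarrow> u \<in> words n q \<longrightarrow> w \<in> words n q \<longrightarrow>
      f (basis_tensor (u \<circ> \<sigma>)) (w \<circ> \<sigma>) = f (basis_tensor u) w)"
proof (cases "q = 0")
  case True
  then show ?thesis by (simp add: schur_def endos_0)
next
  case False
  have "f (basis_tensor (u \<circ> \<sigma>)) (w \<circ> \<sigma>) = f (basis_tensor u) w"
    if f: "f \<in> schur q n" and s: "\<sigma> permutes {1..q}" and u: "u \<in> words n q" for \<sigma> u w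
  proof -
    \<comment> \<open>Equivariance is used for the inverse of \<open>\<sigma>\<close>, which turns
      \<open>u\<close> into \<open>u \<circ> \<sigma>\<close>; evaluation at
      \<open>w \<circ> \<sigma>\<close> then cancels the inverse on the right.\<close>
    have "f (permute_tensor (inv' \<sigma>) (basis_tensor u)) = permute_tensor (inv' \<sigma>) (f (basis_tensor u))"
      using f False permutes_inv[OF s] basis_tensor_in_tensors[OF u, where 'a = 'a]
      by (simp add: schur_def sym_group_carrier)
    then show ?thesis
      using permutes_inv_o[OF s] by (simp add: permute_basis_tensor[OF s])
        (simp add: permute_tensor_def comp_assoc)
  qed
  moreover have "f (permute_tensor \<sigma> t) = permute_tensor \<sigma> (f t)"
    if f: "f \<in> endos n q" and c: "\<forall>\<sigma> u w. \<sigma> permutes {1..q} \<longrightarrow> u \<in> words n q \<longrightarrow> w \<in> words n q \<longrightarrow>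
      f (basis_tensor (u \<circ> \<sigma>)) (w \<circ> \<sigma>) = f (basis_tensor u) w"
      and s: "\<sigma> permutes {1..q}" and t: "t \<in> tensors n q" for \<sigma> t
  proof
    fix w
    note s' = permutes_inv[OF s]
    show "f (permute_tensor \<sigma> t) w = permute_tensor \<sigma> (f t) w"
    proof (cases "w \<in> words n q")
      case w: True
      have "f (permute_tensor \<sigma> t) w = (\<Sum>u\<in>words n q. t (u \<circ> \<sigma>) * f (basis_tensor u) w)"
        unfolding endos_coords[OF f permute_tensor_in_tensors[OF s t]] by (simp add: permute_tensor_def)
      \<comment> \<open>After the substitution of \<open>u \<circ> \<sigma>\<close> for
        \<open>u\<close>, the invariance \<open>c\<close> moves the permutation from the column word
        to the row word.\<close>
      also have "\<dots> = (\<Sum>u\<in>words n q. t u * f (basis_tensor u) (w \<circ> \<sigma>))"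
        by (rule sum.reindex_bij_witness[of _ "\<lambda>u. u \<circ> inv' \<sigma>" "\<lambda>u. u \<circ> \<sigma>"])
          (use c s w in \<open>auto simp: comp_permutes_words_iff[OF s] comp_permutes_words_iff[OF s'] comp_assoc permutes_inv_o[OF s]\<close>)
      also have "\<dots> = permute_tensor \<sigma> (f t) w"
        unfolding permute_tensor_def endos_coords[OF f t] ..
      finally show ?thesis .
    next
      case False
      have "f (permute_tensor \<sigma> t) \<in> tensors n q" "f t \<in> tensors n q"
        using endosD(1)[OF f] t permute_tensor_in_tensors[OF s t] by auto
      then show ?thesis using False
        by (simp add: permute_tensor_def tensors_def comp_permutes_words_iff[OF s])
    qed
  qed
  ultimately show ?thesis using False by (auto simp: schur_def sym_group_carrier)
qed

lemma schur_endos: "f \<in> schur q n \<Longrightarrow> f \<in> endos n q"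
  by (simp add: schur_iff_coeff)

lemma zero_in_schur: "0 \<in> schur q n"
  by (simp add: schur_iff_coeff endos_def) (simp add: tensors_def scale_tensor_def fun_eq_iff)

lemma add_in_schur: "f \<in> schur q n \<Longrightarrow> g \<in> schur q n \<Longrightarrow> f + g \<in> schur q n"
  by (auto simp: schur_iff_coeff endos_def tensors_add)
    (auto simp: scale_tensor_def fun_eq_iff distrib_left)

lemma scale_in_schur: "f \<in> schur q n \<Longrightarrow> scale_endo c f \<in> schur q n"
  by (auto simp: schur_iff_coeff endos_def scale_endo_def tensors_scale)
    (auto simp: scale_tensor_def fun_eq_iff distrib_left mult_ac)

lemma sum_in_schur: "(\<And>i. i \<in> I \<Longrightarrow> f i \<in> schur q n) \<Longrightarrow> sum f I \<in> schur q n"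
  by (induction I rule: infinite_finite_induct) (auto simp: zero_in_schur add_in_schur)

lemma schur_eqI:
  assumes "f \<in> schur q n" "g \<in> schur q n"
    and "\<And>u w. u \<in> words n q \<Longrightarrow> w \<in> words n q \<Longrightarrow> f (basis_tensor u) w = g (basis_tensor u) w"
  shows "f = g"
  using assms endos_eqI schur_endos by blast

section \<open>Coefficients indexed by finite sets of positions\<close>

text \<open>The choice of \<open>e\<close> is immaterial for \<open>f \<in> schur (card A) n\<close>, by \<open>block_coeff_eq\<close> below.\<close>

definition block_coeff ::
    "'k endo \<Rightarrow> nat set \<Rightarrow> (nat \<Rightarrow> nat) \<Rightarrow> (nat \<Rightarrow> nat) \<Rightarrow> 'k::{comm_ring, comm_monoid_mult}" where
  "block_coeff f A u w =
    (let e = SOME e. bij_betw e {1..card A} A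
     in f (basis_tensor (restrict (u \<circ> e) {1..card A})) (restrict (w \<circ> e) {1..card A}))"

text \<open>Two enumerations of \<open>A\<close> differ by a permutation of \<open>{1..a}\<close>,
  and \<open>schur_iff_coeff\<close> says that permuting both words simultaneously does not change
  the coefficient.\<close>

lemma block_coeff_eq:
  assumes f: "f \<in> schur a n" and e: "bij_betw e {1..a} A"
    and u: "u \<in> A \<rightarrow> {1..n}" and w: "w \<in> A \<rightarrow> {1..n}"
  shows "block_coeff f A u w = f (basis_tensor (restrict (u \<circ> e) {1..a})) (restrict (w \<circ> e) {1..a})"
proof -
  have A: "finite A" "card A = a"
    using bij_betw_finite[OF e] bij_betw_same_card[OF e] by auto
  define d where "d = (SOME e. bij_betw e {1..a} A)"
  have d: "bij_betw d {1..a} A"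
    unfolding d_def using someI[of "\<lambda>e. bij_betw e {1..a} A", OF e] .
  \<comment> \<open>The change of enumeration from \<open>e\<close> to the chosen \<open>d\<close>,
    continued by the identity because \<open>permutes\<close> demands it.\<close>
  define \<sigma> where "\<sigma> i = (if i \<in> {1..a} then inv_into {1..a} d (e i) else i)" for i
  have "bij_betw (inv_into {1..a} d \<circ> e) {1..a} {1..a}"
    using bij_betw_trans[OF e bij_betw_inv_into[OF d]] .
  then have "bij_betw \<sigma> {1..a} {1..a}"
    by (rule bij_betw_cong[THEN iffD1, rotated]) (simp add: \<sigma>_def)
  then have \<sigma>: "\<sigma> permutes {1..a}"
    by (rule bij_imp_permutes) (auto simp: \<sigma>_def)
  have de: "d (\<sigma> i) = e i" if "i \<in> {1..a}" for i
    using that bij_betw_inv_into_right[OF d, of "e i"] bij_betwE[OF e] by (auto simp: \<sigma>_def)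
  \<comment> \<open>Outside \<open>{1..a}\<close> both sides are \<open>undefined\<close>, since
    \<open>\<sigma>\<close> fixes those points.\<close>
  have r: "restrict (v \<circ> e) {1..a} = restrict (v \<circ> d) {1..a} \<circ> \<sigma>" for v :: "nat \<Rightarrow> nat"
    using de permutes_in_image[OF \<sigma>] permutes_not_in[OF \<sigma>]
    by (auto simp: fun_eq_iff restrict_def simp del: atLeastAtMost_iff)
  have "restrict (v \<circ> d) {1..a} \<in> words n a" if "v \<in> A \<rightarrow> {1..n}" for v
    using that bij_betwE[OF d] by (auto simp: words_def Pi_iff simp del: atLeastAtMost_iff)
  then have "f (basis_tensor (restrict (u \<circ> d) {1..a} \<circ> \<sigma>)) (restrict (w \<circ> d) {1..a} \<circ> \<sigma>) =
      f (basis_tensor (restrict (u \<circ> d) {1..a})) (restrict (w \<circ> d) {1..a})"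
    using f \<sigma> u w unfolding schur_iff_coeff by blast
  then show ?thesis
    unfolding r[symmetric] by (simp only: block_coeff_def A d_def Let_def)
qed

text \<open>The identity enumerates \<open>{1..q}\<close>, so ordinary matrix coefficients are among
  the block coefficients.\<close>

lemma block_coeff_words:
  assumes "f \<in> schur q n" "u \<in> words n q" "w \<in> words n q"
  shows "block_coeff f {1..q} u w = f (basis_tensor u) w"
proof -
  have "block_coeff f {1..q} u w =
      f (basis_tensor (restrict (u \<circ> id) {1..q})) (restrict (w \<circ> id) {1..q})"
    by (rule block_coeff_eq) (use assms in \<open>auto simp: words_def\<close>)
  then show ?thesis
    using assms by (simp add: words_def PiE_def extensional_restrict)
qed

text \<open>If \<open>d\<close> enumerates \<open>A\<close>, then \<open>e \<circ> d\<close>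
  enumerates the image, and both sides read the same matrix entry.\<close>

lemma block_coeff_comp:
  assumes f: "f \<in> schur (card A) n" and A: "finite A" "inj_on e A"
    and u: "u \<in> e ` A \<rightarrow> {1..n}" and w: "w \<in> e ` A \<rightarrow> {1..n}"
  shows "block_coeff f A (u \<circ> e) (w \<circ> e) = block_coeff f (e ` A) u w"
proof -
  obtain d where d: "bij_betw d {1..card A} A"
    using ex_bij_betw_nat_finite_1[OF A(1)] by blast
  have ed: "bij_betw (e \<circ> d) {1..card A} (e ` A)"
    using d inj_on_imp_bij_betw[OF A(2)] by (rule bij_betw_trans)
  have "u \<circ> e \<in> A \<rightarrow> {1..n}" "w \<circ> e \<in> A \<rightarrow> {1..n}"
    using u w by auto
  from block_coeff_eq[OF f d this] block_coeff_eq[OF f ed u w] show ?thesis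
    by (simp add: comp_assoc)
qed

text \<open>Only the letters at positions in \<open>A\<close> are read. This serves to discard
  restrictions of words to larger sets.\<close>

lemma block_coeff_cong:
  assumes "f \<in> schur (card A) n" and A: "finite A"
    and "u \<in> A \<rightarrow> {1..n}" "w \<in> A \<rightarrow> {1..n}"
    and eq: "\<And>i. i \<in> A \<Longrightarrow> u i = u' i" "\<And>i. i \<in> A \<Longrightarrow> w i = w' i"
  shows "block_coeff f A u w = block_coeff f A u' w'"
proof -
  obtain d where d: "bij_betw d {1..card A} A"
    using ex_bij_betw_nat_finite_1[OF A(1)] by blast
  have "u' \<in> A \<rightarrow> {1..n}" "w' \<in> A \<rightarrow> {1..n}"
    using assms by (auto simp: Pi_iff)
  then have "block_coeff f A u' w' =
      f (basis_tensor (restrict (u' \<circ> d) {1..card A})) (restrict (w' \<circ> d) {1..card A})"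
    using assms(1) by (intro block_coeff_eq[OF _ d])
  moreover have "restrict (u \<circ> d) {1..card A} = restrict (u' \<circ> d) {1..card A}"
      "restrict (w \<circ> d) {1..card A} = restrict (w' \<circ> d) {1..card A}"
    using eq bij_betwE[OF d] by (auto simp: restrict_def)
  ultimately show ?thesis
    using block_coeff_eq[OF assms(1) d assms(3,4)] by simp
qed

lemma block_coeff_add: "block_coeff (f + g) A u w = block_coeff f A u w + block_coeff g A u w"
  by (simp add: block_coeff_def Let_def)

lemma block_coeff_scale: "block_coeff (scale_endo c f) A u w = c * block_coeff f A u w"
  by (simp add: block_coeff_def Let_def scale_endo_def scale_tensor_def)

lemma block_coeff_zero: "block_coeff 0 A u w = 0"
  by (simp add: block_coeff_def Let_def)

lemma block_coeff_sum: "block_coeff (\<Sum>i\<in>I. f i) A u w = (\<Sum>i\<in>I. block_coeff (f i) A u w)"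
  by (induction I rule: infinite_finite_induct)
    (simp_all add: block_coeff_zero block_coeff_add del: zero_fun_apply plus_fun_apply)

text \<open>Recovers the scalar at the empty set, so that the separate clauses of
  \<open>boxtimes\<close> for degree 0 fit the general subset formula.\<close>

lemma block_coeff_scalar_endo: "block_coeff (scalar_endo n c) {} u w = c"
proof -
  have "(basis_tensor (\<lambda>_. undefined) :: 'a tensor) \<in> tensors n 0"
    by (rule basis_tensor_in_tensors) (simp add: words_0)
  then show ?thesis
    by (simp add: block_coeff_def Let_def scalar_endo_def scale_tensor_def restrict_def)
      (simp add: basis_tensor_def)
qed

section \<open>The product as a sum over subsets\<close>

definition k_subsets :: "nat set \<Rightarrow> nat \<Rightarrow> nat set set" where
  "k_subsets Z a = {A. A \<subseteq> Z \<and> card A = a}"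

text \<open>The Young subgroup is the stabiliser of \<open>{1..a}\<close>: a permutation preserving
  this block also preserves the complementary one and is the product of its restrictions to the
  two.\<close>

lemma in_young_subgroup_iff:
  "h \<in> young_subgroup a b \<longleftrightarrow> h permutes {1..a + b} \<and> h ` {1..a} = {1..a}"
proof safe
  fix i assume h: "h \<in> young_subgroup a b"
  then obtain \<rho> \<tau> where h: "h = \<rho> \<circ> \<tau>" and \<rho>: "\<rho> permutes {1..a}" and \<tau>: "\<tau> permutes {a + 1..a + b}"
    unfolding young_subgroup_def by blast
  show "h permutes {1..a + b}"
    unfolding h by (intro permutes_compose permutes_subset[OF \<rho>] permutes_subset[OF \<tau>]) auto
  have "h ` {1..a} = \<rho> ` {1..a}"
    unfolding h image_comp[symmetric] using permutes_not_in[OF \<tau>] by (intro image_cong refl) simp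
  then have "h ` {1..a} = {1..a}"
    using permutes_image[OF \<rho>] by simp
  then show "i \<in> {1..a} \<Longrightarrow> h i \<in> {1..a}" "i \<in> {1..a} \<Longrightarrow> i \<in> h ` {1..a}"
    by (auto simp del: atLeastAtMost_iff)
next
  assume h: "h permutes {1..a + b}" and im: "h ` {1..a} = {1..a}"
  define \<rho> where "\<rho> i = (if i \<in> {1..a} then h i else i)" for i
  define \<tau> where "\<tau> i = (if i \<in> {1..a} then i else h i)" for i
  have inj: "inj h" using h by (rule permutes_inj)
  have "h ` {a + 1..a + b} = h ` ({1..a + b} - {1..a})"
    by (rule arg_cong[where f = "image h"]) auto
  also have "\<dots> = {1..a + b} - {1..a}"
    using image_set_diff[OF inj] permutes_image[OF h] im by simp
  finally have im': "h ` {a + 1..a + b} = {a + 1..a + b}" by auto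
  have "\<rho> permutes {1..a}"
  proof (rule bij_imp_permutes)
    have "bij_betw h {1..a} {1..a}"
      using inj im by (simp add: bij_betw_def inj_on_def)
    then show "bij_betw \<rho> {1..a} {1..a}"
      by (rule bij_betw_cong[THEN iffD1, rotated]) (simp add: \<rho>_def)
  qed (auto simp: \<rho>_def)
  moreover have "\<tau> permutes {a + 1..a + b}"
  proof (rule bij_imp_permutes)
    have "bij_betw h {a + 1..a + b} {a + 1..a + b}"
      using inj im' by (simp add: bij_betw_def inj_on_def)
    then show "bij_betw \<tau> {a + 1..a + b} {a + 1..a + b}"
      by (rule bij_betw_cong[THEN iffD1, rotated]) (simp add: \<tau>_def)
    show "\<tau> i = i" if "i \<notin> {a + 1..a + b}" for i
      using that permutes_not_in[OF h, of i] by (auto simp: \<tau>_def)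
  qed
  moreover have "h = \<rho> \<circ> \<tau>"
  proof
    fix i
    \<comment> \<open>Points outside the first block stay outside, so \<open>\<rho>\<close> does not
      move what \<open>\<tau>\<close> has already moved.\<close>
    have "h i \<notin> {1..a}" if "i \<notin> {1..a}"
      using that im inj by (metis imageE injD)
    then show "h i = (\<rho> \<circ> \<tau>) i"
      by (auto simp: \<rho>_def \<tau>_def simp del: atLeastAtMost_iff)
  qed
  ultimately show "h \<in> young_subgroup a b"
    unfolding young_subgroup_def by blast
qed

text \<open>This is the orbit-stabiliser correspondence. Permutations with the same image of
  \<open>{1..a}\<close> lie in the same coset, every \<open>a\<close>-element subset is such an
  image, and \<open>L\<close> meets each coset exactly once.\<close>

lemma left_coset_reps_bij:
  assumes L: "left_coset_reps a b L"
  shows "bij_betw (\<lambda>\<sigma>. \<sigma> ` {1..a}) L (k_subsets {1..a + b} a)"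
proof -
  have perm: "\<sigma> permutes {1..a + b}" if "\<sigma> \<in> L" for \<sigma>
    using L that by (auto simp: left_coset_reps_def sym_group_carrier)
  define C where "C \<pi> = \<pi> <#\<^bsub>sym_group (a + b)\<^esub> young_subgroup a b" for \<pi>
  have C: "\<sigma> \<in> C \<pi> \<longleftrightarrow> (\<exists>h. h permutes {1..a + b} \<and> h ` {1..a} = {1..a} \<and> \<sigma> = \<pi> \<circ> h)" for \<sigma> \<pi>
    unfolding C_def l_coset_def sym_group_mult using in_young_subgroup_iff by auto
  have ex1: "\<exists>!\<sigma>. \<sigma> \<in> L \<inter> C \<pi>" if "\<pi> permutes {1..a + b}" for \<pi>
    using L that unfolding left_coset_reps_def LCOSETS_def C_def by (auto simp: sym_group_carrier)
  show ?thesis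
  proof (rule bij_betw_imageI)
    show "inj_on (\<lambda>\<sigma>. \<sigma> ` {1..a}) L"
    proof
      fix \<sigma> \<tau> assume \<sigma>: "\<sigma> \<in> L" and \<tau>: "\<tau> \<in> L" and eq: "\<sigma> ` {1..a} = \<tau> ` {1..a}"
      note ps = perm[OF \<sigma>] and pt = perm[OF \<tau>]
      have "\<sigma> \<in> C \<sigma>"
        unfolding C using permutes_id[of "{1..a + b}"] by (intro exI[of _ id]) simp
      \<comment> \<open>Equal images make \<open>inv' \<sigma> \<circ> \<tau>\<close> stabilise
        \<open>{1..a}\<close>, so both representatives lie in the coset of \<open>\<sigma>\<close>
        and uniqueness applies.\<close>
      moreover have "\<tau> \<in> C \<sigma>"
        unfolding C
      proof (intro exI[of _ "inv' \<sigma> \<circ> \<tau>"] conjI)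
        show "inv' \<sigma> \<circ> \<tau> permutes {1..a + b}"
          using permutes_compose[OF pt permutes_inv[OF ps]] .
        show "(inv' \<sigma> \<circ> \<tau>) ` {1..a} = {1..a}"
          unfolding image_comp[symmetric] eq[symmetric] unfolding image_comp permutes_inv_o(2)[OF ps] by simp
        show "\<tau> = \<sigma> \<circ> (inv' \<sigma> \<circ> \<tau>)"
          unfolding comp_assoc[symmetric] permutes_inv_o(1)[OF ps] by simp
      qed
      ultimately show "\<sigma> = \<tau>"
        using ex1[OF ps] \<sigma> \<tau> by blast
    qed
    show "(\<lambda>\<sigma>. \<sigma> ` {1..a}) ` L = k_subsets {1..a + b} a"
    proof (intro equalityI subsetI)
      fix A assume "A \<in> (\<lambda>\<sigma>. \<sigma> ` {1..a}) ` L"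
      then obtain \<sigma> where "\<sigma> \<in> L" and A: "A = \<sigma> ` {1..a}" by blast
      then have \<sigma>: "\<sigma> permutes {1..a + b}" using perm by blast
      have "\<sigma> ` {1..a} \<subseteq> \<sigma> ` {1..a + b}" by (rule image_mono) auto
      then show "A \<in> k_subsets {1..a + b} a"
        using permutes_image[OF \<sigma>] card_image[OF inj_on_subset[OF permutes_inj[OF \<sigma>] subset_UNIV], of "{1..a}"]
        by (simp add: k_subsets_def A)
    next
      fix A assume "A \<in> k_subsets {1..a + b} a"
      then have A: "A \<subseteq> {1..a + b}" and cA: "card A = a" by (auto simp: k_subsets_def)
      have fA: "finite A" using A finite_subset by blast
      obtain d where d: "bij_betw d {1..a} A"
        using finite_same_card_bij[of "{1..a}" A] fA cA by auto
      have "card ({1..a + b} - A) = b"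
        using card_Diff_subset[OF fA A] cA by simp
      then obtain d' where d': "bij_betw d' {a + 1..a + b} ({1..a + b} - A)"
        using finite_same_card_bij[of "{a + 1..a + b}" "{1..a + b} - A"] by auto
      \<comment> \<open>Some permutation carrying \<open>{1..a}\<close> onto \<open>A\<close>, glued
        from bijections of the two blocks. The representative of its coset has the same image of
        \<open>{1..a}\<close>.\<close>
      define \<pi> where "\<pi> i = (if i \<in> {1..a} then d i else if i \<in> {a + 1..a + b} then d' i else i)" for i
      have 1: "bij_betw \<pi> {1..a} A"
        using d by (rule bij_betw_cong[THEN iffD1, rotated]) (simp add: \<pi>_def)
      have 2: "bij_betw \<pi> {a + 1..a + b} ({1..a + b} - A)"
        using d' by (rule bij_betw_cong[THEN iffD1, rotated]) (auto simp: \<pi>_def)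
      have "bij_betw \<pi> ({1..a} \<union> {a + 1..a + b}) (A \<union> ({1..a + b} - A))"
        using 1 2 by (rule bij_betw_combine) auto
      moreover have "{1..a} \<union> {a + 1..a + b} = {1..a + b}" "A \<union> ({1..a + b} - A) = {1..a + b}"
        using A by auto
      ultimately have "bij_betw \<pi> {1..a + b} {1..a + b}" by simp
      then have "\<pi> permutes {1..a + b}"
        by (rule bij_imp_permutes) (auto simp: \<pi>_def)
      from ex1[OF this] obtain \<sigma> where \<sigma>: "\<sigma> \<in> L" "\<sigma> \<in> C \<pi>" by blast
      then obtain h where "h ` {1..a} = {1..a}" "\<sigma> = \<pi> \<circ> h" unfolding C by blast
      then have "\<sigma> ` {1..a} = A"
        using bij_betw_imp_surj_on[OF 1] by (metis image_comp)
      then show "A \<in> (\<lambda>\<sigma>. \<sigma> ` {1..a}) ` L" using \<sigma>(1) by blast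
    qed
  qed
qed

section \<open>Matrix coefficients of the product\<close>

text \<open>A word is determined by its two parts, so its basis tensor is the product of the basis
  tensors of the parts and \<open>tensor_endo_tensor_mult\<close> applies. The matrix of the tensor
  product is thus a Kronecker product.\<close>

lemma tensor_endo_basis_tensor:
  assumes f: "f \<in> endos n a" and g: "g \<in> endos n b"
    and u: "u \<in> words n (a + b)" and w: "w \<in> words n (a + b)"
  shows "tensor_endo n a b f g (basis_tensor u) w =
    f (basis_tensor (first_part a u)) (first_part a w) *
    g (basis_tensor (last_part a b u)) (last_part a b w)"
proof -
  have parts: "v = u" if "v \<in> words n (a + b)" "first_part a v = first_part a u"
    "last_part a b v = last_part a b u" for v
  proof (rule PiE_ext[where k = "{1..a + b}" and s = "\<lambda>_. {1..n}"])
    show "v \<in> {1..a + b} \<rightarrow>\<^sub>E {1..n}" "u \<in> {1..a + b} \<rightarrow>\<^sub>E {1..n}"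
      using that(1) u by (simp_all add: words_def)
    fix i assume i: "i \<in> {1..a + b}"
    show "v i = u i"
    proof (cases "i \<le> a")
      case True
      then show ?thesis using i fun_cong[OF that(2), of i] by (simp add: first_part_def)
    next
      case False
      then have "i - a \<in> {1..b}" "a + (i - a) = i" using i by auto
      then show ?thesis using fun_cong[OF that(3), of "i - a"]
        by (simp add: last_part_def del: atLeastAtMost_iff)
    qed
  qed
  have "basis_tensor u = tensor_mult n a b (basis_tensor (first_part a u)) (basis_tensor (last_part a b u) :: 'a tensor)"
  proof
    fix v
    show "basis_tensor u v =
        tensor_mult n a b (basis_tensor (first_part a u)) (basis_tensor (last_part a b u) :: 'a tensor) v"
      using parts[of v] u by (cases "v = u") (auto simp: basis_tensor_def tensor_mult_def)
  qed
  then show ?thesis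
    using tensor_endo_tensor_mult[OF f g basis_tensor_in_tensors[OF first_part_in_words[OF u]]
        basis_tensor_in_tensors[OF last_part_in_words[OF u]]] w
    by (simp add: tensor_mult_def)
qed

text \<open>One graded piece of the convolution of set functions, the words \<open>u\<close> and
  \<open>w\<close> being held fixed.\<close>

definition block_conv ::
    "'k endo \<Rightarrow> 'k endo \<Rightarrow> nat \<Rightarrow> nat set \<Rightarrow> (nat \<Rightarrow> nat) \<Rightarrow> (nat \<Rightarrow> nat) \<Rightarrow> 'k::{comm_ring, comm_monoid_mult}"
  where "block_conv f g a Z u w =
    (\<Sum>A\<in>k_subsets Z a. block_coeff f A u w * block_coeff g (Z - A) u w)"

text \<open>Conjugation by \<open>\<sigma>\<close> makes \<open>f\<close> act on the positions in
  the image of \<open>{1..a}\<close> and \<open>g\<close> on the others;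
  \<open>left_coset_reps_bij\<close> then turns the sum over representatives into one over subsets.
  In the scalar cases a single subset remains, the empty or the full one.\<close>

lemma boxtimes_basis_tensor:
  fixes f g :: "'k::{comm_ring, comm_monoid_mult} endo"
  assumes L: "a \<ge> 1 \<Longrightarrow> b \<ge> 1 \<Longrightarrow> left_coset_reps a b (L a b)"
    and f: "f \<in> schur a n" and g: "g \<in> schur b n"
    and u: "u \<in> words n (a + b)" and w: "w \<in> words n (a + b)"
  shows "boxtimes n L a b f g (basis_tensor u) w = block_conv f g a {1..a + b} u w"
proof -
  consider "a = 0" | "a > 0" "b = 0" | "a \<ge> 1" "b \<ge> 1" by linarith
  then show ?thesis
  proof cases
    case 1
    then obtain c where c: "f = scalar_endo n c"
      using f by (auto simp: schur_def)
    \<comment> \<open>Infinite sets also have cardinality 0, so finiteness of the ambient set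
      matters here.\<close>
    have "k_subsets {1..a + b} a = {{}}"
      using 1 by (auto simp: k_subsets_def card_eq_0_iff dest: finite_subset)
    then show ?thesis
      using 1 u w block_coeff_words[OF g]
      by (simp add: boxtimes_def c the_inv_f_f[OF inj_scalar_endo] scale_endo_def scale_tensor_def
          block_conv_def block_coeff_scalar_endo)
  next
    case 2
    then obtain c where c: "g = scalar_endo n c"
      using g by (auto simp: schur_def)
    have "k_subsets {1..a + b} a = {{1..a}}"
      using 2 card_subset_eq[of "{1..a}"] by (auto simp: k_subsets_def)
    then show ?thesis
      using 2 u w block_coeff_words[OF f]
      by (simp add: boxtimes_def c the_inv_f_f[OF inj_scalar_endo] scale_endo_def scale_tensor_def
          block_conv_def block_coeff_scalar_endo mult.commute)
  next
    case 3
    note reps = L[OF 3]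
    have ran: "v \<in> A \<rightarrow> {1..n}" if "v \<in> words n (a + b)" "A \<subseteq> {1..a + b}" for v A
      using that by (auto simp: words_def)
    have "boxtimes n L a b f g (basis_tensor u) w =
        (\<Sum>\<sigma>\<in>L a b. permute_tensor \<sigma> (tensor_endo n a b f g (permute_tensor (inv' \<sigma>) (basis_tensor u))) w)"
      using 3 basis_tensor_in_tensors[OF u, where 'a = 'k] by (simp add: boxtimes_def sum_fun_apply)
    also have "\<dots> = (\<Sum>\<sigma>\<in>L a b. block_coeff f (\<sigma> ` {1..a}) u w * block_coeff g ({1..a + b} - \<sigma> ` {1..a}) u w)"
    proof (rule sum.cong[OF refl])
      fix \<sigma> assume "\<sigma> \<in> L a b"
      then have \<sigma>: "\<sigma> permutes {1..a + b}"
        using reps by (auto simp: left_coset_reps_def sym_group_carrier)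
      have inj: "inj \<sigma>" using \<sigma> by (rule permutes_inj)
      have u': "u \<circ> \<sigma> \<in> words n (a + b)" and w': "w \<circ> \<sigma> \<in> words n (a + b)"
        using u w by (simp_all add: comp_permutes_words_iff[OF \<sigma>])
      define A where "A = \<sigma> ` {1..a}"
      have "\<sigma> ` {1..a} \<subseteq> \<sigma> ` {1..a + b}" by (rule image_mono) auto
      then have A: "A \<subseteq> {1..a + b}" using permutes_image[OF \<sigma>] by (simp add: A_def)
      \<comment> \<open>The enumerations needed by \<open>block_coeff_eq\<close> are
        \<open>\<sigma>\<close> itself for \<open>A\<close> and \<open>\<sigma>\<close> shifted by
        \<open>a\<close> for the complement.\<close>
      have bij: "bij_betw \<sigma> {1..a} A"
        using inj by (simp add: A_def bij_betw_def inj_on_def)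
      have "(\<lambda>j. \<sigma> (a + j)) ` {1..b} = \<sigma> ` ((+) a ` {1..b})" unfolding image_image ..
      also have "(+) a ` {1..b} = {1..a + b} - {1..a}" by (simp, auto)
      also have "\<sigma> ` \<dots> = {1..a + b} - A"
        using image_set_diff[OF inj] permutes_image[OF \<sigma>] by (simp add: A_def)
      finally have "(\<lambda>j. \<sigma> (a + j)) ` {1..b} = {1..a + b} - A" .
      then have bij': "bij_betw (\<lambda>j. \<sigma> (a + j)) {1..b} ({1..a + b} - A)"
        using inj_on_subset[OF inj subset_UNIV] by (auto simp: bij_betw_def intro!: inj_onI dest: injD[OF inj])
      have "permute_tensor \<sigma> (tensor_endo n a b f g (permute_tensor (inv' \<sigma>) (basis_tensor u))) w =
          tensor_endo n a b f g (basis_tensor (u \<circ> \<sigma>)) (w \<circ> \<sigma>)"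
        unfolding permute_basis_tensor[OF \<sigma>] by (simp add: permute_tensor_def)
      also have "\<dots> = f (basis_tensor (first_part a (u \<circ> \<sigma>))) (first_part a (w \<circ> \<sigma>)) *
          g (basis_tensor (last_part a b (u \<circ> \<sigma>))) (last_part a b (w \<circ> \<sigma>))"
        by (rule tensor_endo_basis_tensor[OF schur_endos[OF f] schur_endos[OF g] u' w'])
      also have "\<dots> = block_coeff f A u w * block_coeff g ({1..a + b} - A) u w"
        unfolding block_coeff_eq[OF f bij ran[OF u A] ran[OF w A]]
          block_coeff_eq[OF g bij' ran[OF u Diff_subset] ran[OF w Diff_subset]]
        by (simp add: first_part_def last_part_def comp_def)
      finally show "permute_tensor \<sigma> (tensor_endo n a b f g (permute_tensor (inv' \<sigma>) (basis_tensor u))) w =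
          block_coeff f (\<sigma> ` {1..a}) u w * block_coeff g ({1..a + b} - \<sigma> ` {1..a}) u w"
        by (simp add: A_def)
    qed
    also have "\<dots> = block_conv f g a {1..a + b} u w"
      unfolding block_conv_def by (rule sum.reindex_bij_betw[OF left_coset_reps_bij[OF reps]])
    finally show ?thesis .
  qed
qed

text \<open>The map \<open>e\<close> carries subsets to subsets of the same size and respects
  complements, and block coefficients follow along by \<open>block_coeff_comp\<close>. Taking a
  permutation for \<open>e\<close> yields equivariance of the product; taking an enumeration of
  \<open>Z\<close> yields its coefficients on arbitrary finite sets.\<close>

lemma block_conv_reindex:
  assumes f: "f \<in> schur a n" and g: "g \<in> schur b n"
    and e: "bij_betw e {1..a + b} Z" and u: "u \<in> Z \<rightarrow> {1..n}" and w: "w \<in> Z \<rightarrow> {1..n}"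
  shows "block_conv f g a {1..a + b} (restrict (u \<circ> e) {1..a + b}) (restrict (w \<circ> e) {1..a + b}) =
    block_conv f g a Z u w"
proof -
  let ?I = "{1..a + b}"
  have inj: "inj_on e ?I" and im: "e ` ?I = Z"
    using e by (auto simp: bij_betw_def)
  have block: "block_coeff h A (restrict (u \<circ> e) ?I) (restrict (w \<circ> e) ?I) = block_coeff h (e ` A) u w"
    if h: "h \<in> schur (card A) n" and A: "A \<subseteq> ?I" for h A
  proof -
    have finA: "finite A" using A finite_subset by blast
    have ran: "v \<circ> e \<in> A \<rightarrow> {1..n}" "v \<in> e ` A \<rightarrow> {1..n}" if "v \<in> Z \<rightarrow> {1..n}" for v
      using that A unfolding im[symmetric] by (auto simp del: atLeastAtMost_iff simp: Pi_iff subset_iff)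
    have "block_coeff h A (u \<circ> e) (w \<circ> e) = block_coeff h A (restrict (u \<circ> e) ?I) (restrict (w \<circ> e) ?I)"
      by (rule block_coeff_cong[OF h finA ran(1)[OF u] ran(1)[OF w]]) (use A in \<open>auto simp: restrict_def\<close>)
    then show ?thesis
      using block_coeff_comp[OF h finA inj_on_subset[OF inj A] ran(2)[OF u] ran(2)[OF w]] by simp
  qed
  have bij: "bij_betw (image e) (k_subsets ?I a) (k_subsets Z a)"
  proof (rule bij_betw_imageI)
    show "inj_on (image e) (k_subsets ?I a)"
      using inj_on_image_Pow[OF inj] by (rule inj_on_subset) (auto simp: k_subsets_def)
    have "card (e ` A) = card A" if "A \<subseteq> ?I" for A
      using card_image inj_on_subset[OF inj that] by blast
    note card = this
    show "image e ` k_subsets ?I a = k_subsets Z a"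
    proof (intro equalityI subsetI)
      fix B assume "B \<in> image e ` k_subsets ?I a"
      then obtain A where "A \<subseteq> ?I" "card A = a" "B = e ` A" by (auto simp: k_subsets_def)
      then show "B \<in> k_subsets Z a"
        using card[of A] im by (auto simp: k_subsets_def simp del: atLeastAtMost_iff)
    next
      fix B assume "B \<in> k_subsets Z a"
      then have "B \<subseteq> e ` ?I" and cB: "card B = a"
        unfolding im by (auto simp: k_subsets_def)
      then obtain A where A: "A \<subseteq> ?I" "B = e ` A" by (meson subset_imageE)
      then have "A \<in> k_subsets ?I a" using card[of A] cB by (simp add: k_subsets_def)
      then show "B \<in> image e ` k_subsets ?I a" using A(2) by blast
    qed
  qed
  have "block_conv f g a ?I (restrict (u \<circ> e) ?I) (restrict (w \<circ> e) ?I) =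
      (\<Sum>A\<in>k_subsets ?I a. block_coeff f (e ` A) u w * block_coeff g (Z - e ` A) u w)"
    unfolding block_conv_def
  proof (rule sum.cong[OF refl])
    fix A assume "A \<in> k_subsets ?I a"
    then have A: "A \<subseteq> ?I" "card A = a" by (auto simp: k_subsets_def)
    have "card (?I - A) = b"
      using A card_Diff_subset[of A ?I] finite_subset[OF A(1)] by simp
    moreover have "e ` (?I - A) = Z - e ` A"
      using inj_on_image_set_diff[OF inj, of ?I A] A im by simp
    ultimately show "block_coeff f A (restrict (u \<circ> e) ?I) (restrict (w \<circ> e) ?I) *
        block_coeff g (?I - A) (restrict (u \<circ> e) ?I) (restrict (w \<circ> e) ?I) =
        block_coeff f (e ` A) u w * block_coeff g (Z - e ` A) u w"
      using block[of f A] block[of g "?I - A"] A f g by simp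
  qed
  also have "\<dots> = block_conv f g a Z u w"
    unfolding block_conv_def by (rule sum.reindex_bij_betw[OF bij])
  finally show ?thesis .
qed

section \<open>Closure of the Schur modules under the product\<close>

lemma tensor_endo_in_tensors: "tensor_endo n a b f g t \<in> tensors n (a + b)"
  by (simp add: tensors_def tensor_endo_def sum_fun_apply tensor_mult_def scale_tensor_def)

lemma tensor_endo_add: "tensor_endo n a b f g (s + t) = tensor_endo n a b f g s + tensor_endo n a b f g t"
  by (simp add: tensor_endo_def sum_fun_apply fun_eq_iff scale_tensor_def distrib_right sum.distrib)

lemma tensor_endo_scale:
  "tensor_endo n a b f g (scale_tensor c t) = scale_tensor c (tensor_endo n a b f g t)"
  by (simp add: tensor_endo_def sum_fun_apply fun_eq_iff scale_tensor_def sum_distrib_left mult_ac)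

text \<open>Linearity is inherited by sums of conjugates. Equivariance comes from the subset
  formula, which is invariant under relabelling positions, so no change of coset representatives has
  to be discussed.\<close>

lemma boxtimes_in_schur:
  assumes L: "a \<ge> 1 \<Longrightarrow> b \<ge> 1 \<Longrightarrow> left_coset_reps a b (L a b)"
    and f: "f \<in> schur a n" and g: "g \<in> schur b n"
  shows "boxtimes n L a b f g \<in> schur (a + b) n"
proof -
  consider "a = 0" | "b = 0" | "a \<ge> 1" "b \<ge> 1" by linarith
  then have endo: "boxtimes n L a b f g \<in> endos n (a + b)"
  proof cases
    case 3
    have perm: "\<sigma> permutes {1..a + b}" if "\<sigma> \<in> L a b" for \<sigma>
      using L[OF 3] that by (auto simp: left_coset_reps_def sym_group_carrier)
    define F where "F \<sigma> t = permute_tensor \<sigma> (tensor_endo n a b f g (permute_tensor (inv' \<sigma>) t))" for \<sigma> t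
    have Fin: "F \<sigma> t \<in> tensors n (a + b)" if "\<sigma> \<in> L a b" for \<sigma> t
      unfolding F_def by (intro permute_tensor_in_tensors perm that tensor_endo_in_tensors)
    have "permute_tensor \<sigma> (s + t) = permute_tensor \<sigma> s + permute_tensor \<sigma> t" for \<sigma> and s t :: "'a tensor"
      by (simp add: permute_tensor_def fun_eq_iff)
    then have Fadd: "F \<sigma> (s + t) = F \<sigma> s + F \<sigma> t" for \<sigma> s t
      by (simp only: F_def tensor_endo_add)
    have "permute_tensor \<sigma> (scale_tensor c t) = scale_tensor c (permute_tensor \<sigma> t)" for \<sigma> c and t :: "'a tensor"
      by (simp add: permute_tensor_def scale_tensor_def)
    then have Fscale: "F \<sigma> (scale_tensor c t) = scale_tensor c (F \<sigma> t)" for \<sigma> c t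
      by (simp only: F_def tensor_endo_scale)
    have "boxtimes n L a b f g = (\<lambda>t. if t \<in> tensors n (a + b) then \<Sum>\<sigma>\<in>L a b. F \<sigma> t else 0)"
      using 3 unfolding boxtimes_def F_def by simp
    moreover have "(\<Sum>\<sigma>\<in>L a b. F \<sigma> t) \<in> tensors n (a + b)" for t
      using Fin by (simp add: tensors_def sum_fun_apply)
    moreover have "(\<Sum>\<sigma>\<in>L a b. scale_tensor c (F \<sigma> t)) = scale_tensor c (\<Sum>\<sigma>\<in>L a b. F \<sigma> t)" for c t
      by (simp add: fun_eq_iff sum_fun_apply scale_tensor_def sum_distrib_left)
    ultimately show ?thesis
      by (simp add: endos_def tensors_add tensors_scale Fadd Fscale sum.distrib)
  qed (use schur_endos[OF scale_in_schur[OF f]] schur_endos[OF scale_in_schur[OF g]] in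
      \<open>auto simp: boxtimes_def\<close>)
  have "boxtimes n L a b f g (basis_tensor (u \<circ> \<sigma>)) (w \<circ> \<sigma>) = boxtimes n L a b f g (basis_tensor u) w"
    if \<sigma>: "\<sigma> permutes {1..a + b}" and u: "u \<in> words n (a + b)" and w: "w \<in> words n (a + b)" for \<sigma> u w
  proof -
    have u': "u \<circ> \<sigma> \<in> words n (a + b)" and w': "w \<circ> \<sigma> \<in> words n (a + b)"
      using u w by (simp_all add: comp_permutes_words_iff[OF \<sigma>])
    have "restrict (v \<circ> \<sigma>) {1..a + b} = v \<circ> \<sigma>" if "v \<circ> \<sigma> \<in> words n (a + b)" for v
      using that extensional_restrict unfolding words_def PiE_def by blast
    moreover have "u \<in> {1..a + b} \<rightarrow> {1..n}" "w \<in> {1..a + b} \<rightarrow> {1..n}"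
      using u w by (auto simp: words_def)
    ultimately show ?thesis
      using block_conv_reindex[OF f g permutes_imp_bij[OF \<sigma>], of u w] u' w'
      by (simp del: One_nat_def add: boxtimes_basis_tensor[of a b L, OF L f g u w] boxtimes_basis_tensor[of a b L, OF L f g u' w'])
  qed
  with endo show ?thesis by (simp add: schur_iff_coeff)
qed

text \<open>The formula is needed on sets other than \<open>{1..a + b}\<close> because an iterated
  product evaluates its inner factor on subsets.\<close>

lemma block_coeff_boxtimes:
  assumes L: "a \<ge> 1 \<Longrightarrow> b \<ge> 1 \<Longrightarrow> left_coset_reps a b (L a b)"
    and f: "f \<in> schur a n" and g: "g \<in> schur b n"
    and Z: "finite Z" "card Z = a + b" and u: "u \<in> Z \<rightarrow> {1..n}" and w: "w \<in> Z \<rightarrow> {1..n}"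
  shows "block_coeff (boxtimes n L a b f g) Z u w = block_conv f g a Z u w"
proof -
  obtain e where e: "bij_betw e {1..a + b} Z"
    using ex_bij_betw_nat_finite_1[OF Z(1)] Z(2) by metis
  have "restrict (v \<circ> e) {1..a + b} \<in> words n (a + b)" if "v \<in> Z \<rightarrow> {1..n}" for v
    using that bij_betwE[OF e] by (auto simp: words_def Pi_iff simp del: atLeastAtMost_iff)
  then show ?thesis
    using block_coeff_eq[OF boxtimes_in_schur[of a b L, OF L f g] e u w]
      boxtimes_basis_tensor[of a b L, OF L f g] block_conv_reindex[OF f g e u w] u w
    by simp
qed

section \<open>The algebra\<close>

text \<open>Complementation in \<open>Z\<close> is an involution that exchanges the two
  factors.\<close>

lemma subset_conv_commute:
  fixes f g :: "'a set \<Rightarrow> 'k::comm_semiring_0"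
  shows "(\<Sum>A\<in>Pow Z. f A * g (Z - A)) = (\<Sum>A\<in>Pow Z. g A * f (Z - A))"
  by (rule sum.reindex_bij_witness[of _ "\<lambda>A. Z - A" "\<lambda>A. Z - A"])
    (auto simp: double_diff mult.commute)

text \<open>Both sides run over the ordered splittings of \<open>Z\<close> into three disjoint,
  possibly empty parts.\<close>

lemma subset_conv_assoc:
  fixes f g h :: "'a set \<Rightarrow> 'k::comm_semiring_0"
  assumes Z: "finite Z"
  shows "(\<Sum>A\<in>Pow Z. (\<Sum>B\<in>Pow A. f B * g (A - B)) * h (Z - A)) =
    (\<Sum>B\<in>Pow Z. f B * (\<Sum>C\<in>Pow (Z - B). g C * h (Z - B - C)))"
proof -
  have fin: "\<forall>A\<in>Pow Z. finite (Pow A)" "\<forall>A\<in>Pow Z. finite (Pow (Z - A))"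
    using Z finite_subset by auto
  have "(\<Sum>A\<in>Pow Z. (\<Sum>B\<in>Pow A. f B * g (A - B)) * h (Z - A)) =
      (\<Sum>(A, B)\<in>Sigma (Pow Z) Pow. f B * g (A - B) * h (Z - A))"
    using sum.Sigma[OF _ fin(1)] Z by (simp add: sum_distrib_right)
  also have "\<dots> = (\<Sum>(B, C)\<in>Sigma (Pow Z) (\<lambda>B. Pow (Z - B)). f B * (g C * h (Z - B - C)))"
  \<comment> \<open>The parts are \<open>B\<close>, \<open>A - B\<close> and \<open>Z - A\<close>;
    with \<open>C = A - B\<close> the outer set is recovered as \<open>B \<union> C\<close>.\<close>
  proof (rule sum.reindex_bij_witness[of _ "\<lambda>(B, C). (B \<union> C, B)" "\<lambda>(A, B). (B, A - B)"])
    fix p assume "p \<in> Sigma (Pow Z) (\<lambda>A. Pow A)"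
    then obtain A B where p: "p = (A, B)" "B \<subseteq> A" "A \<subseteq> Z" by auto
    then have "Z - B - (A - B) = Z - A" by auto
    then show "(case case p of (A, B) \<Rightarrow> (B, A - B) of (B, C) \<Rightarrow> f B * (g C * h (Z - B - C))) =
        (case p of (A, B) \<Rightarrow> f B * g (A - B) * h (Z - A))"
      by (simp add: p(1) mult.assoc)
  qed auto
  also have "\<dots> = (\<Sum>B\<in>Pow Z. f B * (\<Sum>C\<in>Pow (Z - B). g C * h (Z - B - C)))"
    using sum.Sigma[OF _ fin(2), of "\<lambda>B C. f B * (g C * h (Z - B - C))"] Z
    by (simp add: sum_distrib_left)
  finally show ?thesis .
qed

section \<open>The direct sum as a space of set functions\<close>

text \<open>The size of the set selects the component, so a single set function records all degrees
  of \<open>F\<close> at once.\<close>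

definition total_coeff ::
    "(nat \<Rightarrow> 'k endo) \<Rightarrow> nat set \<Rightarrow> (nat \<Rightarrow> nat) \<Rightarrow> (nat \<Rightarrow> nat) \<Rightarrow> 'k::{comm_ring, comm_monoid_mult}" where
  "total_coeff F A u w = block_coeff (F (card A)) A u w"

lemma total_coeff_add: "total_coeff (F + G) A u w = total_coeff F A u w + total_coeff G A u w"
  unfolding total_coeff_def plus_fun_apply[of F] by (rule block_coeff_add)

lemma schur_sumD: "F \<in> schur_sum n \<Longrightarrow> F q \<in> schur q n"
  by (simp add: schur_sum_def)

text \<open>The sets \<open>{1..q}\<close> already recover every matrix entry of every component.
  The ring laws are verified through this criterion.\<close>

lemma schur_sum_eqI:
  assumes F: "F \<in> schur_sum n" and G: "G \<in> schur_sum n"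
    and eq: "\<And>Z u w. finite Z \<Longrightarrow> u \<in> Z \<rightarrow> {1..n} \<Longrightarrow> w \<in> Z \<rightarrow> {1..n} \<Longrightarrow>
      total_coeff F Z u w = total_coeff G Z u w"
  shows "F = G"
proof
  fix q
  show "F q = G q"
  proof (rule schur_eqI[OF schur_sumD[OF F] schur_sumD[OF G]])
    fix u w assume uw: "u \<in> words n q" "w \<in> words n q"
    have "total_coeff F {1..q} u w = total_coeff G {1..q} u w"
      by (rule eq) (use uw in \<open>auto simp: words_def\<close>)
    then show "F q (basis_tensor u) w = G q (basis_tensor u) w"
      using block_coeff_words[OF schur_sumD[OF F] uw] block_coeff_words[OF schur_sumD[OF G] uw]
      by (simp add: total_coeff_def)
  qed
qed

lemma schur_sum_zero: "0 \<in> schur_sum n"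
  by (simp add: schur_sum_def zero_in_schur del: zero_fun_apply)
    (simp add: zero_fun_def zero_in_schur[unfolded zero_fun_def])

lemma schur_sum_add: "F \<in> schur_sum n \<Longrightarrow> G \<in> schur_sum n \<Longrightarrow> F + G \<in> schur_sum n"
proof -
  assume F: "F \<in> schur_sum n" and G: "G \<in> schur_sum n"
  have "{q. (F + G) q \<noteq> 0} \<subseteq> {q. F q \<noteq> 0} \<union> {q. G q \<noteq> 0}"
    unfolding plus_fun_apply[of F] by auto
  then show ?thesis
    using F G add_in_schur finite_subset unfolding schur_sum_def plus_fun_apply[of F] by blast
qed

definition schur_scale :: "'k \<Rightarrow> (nat \<Rightarrow> 'k endo) \<Rightarrow> nat \<Rightarrow> 'k::{comm_ring, comm_monoid_mult} endo" where
  "schur_scale c F = (\<lambda>q. scale_endo c (F q))"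

lemma total_coeff_scale: "total_coeff (schur_scale c F) A u w = c * total_coeff F A u w"
  by (simp add: total_coeff_def schur_scale_def block_coeff_scale)

lemma scale_endo_zero: "scale_endo c 0 = 0"
  by (simp add: scale_endo_def scale_tensor_def fun_eq_iff)

text \<open>Provides additive inverses that stay in the direct sum by
  \<open>schur_sum_scale\<close>.\<close>

lemma schur_scale_minus_one: "schur_scale (- 1) F + F = 0"
  by (simp add: schur_scale_def scale_endo_def scale_tensor_def fun_eq_iff)

lemma schur_sum_scale:
  assumes F: "F \<in> schur_sum n"
  shows "schur_scale c F \<in> schur_sum n"
proof -
  have "{q. schur_scale c F q \<noteq> 0} \<subseteq> {q. F q \<noteq> 0}"
    by (auto simp: schur_scale_def scale_endo_zero)
  moreover have "schur_scale c F q \<in> schur q n" for q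
    using schur_sumD[OF F] by (simp add: schur_scale_def scale_in_schur)
  ultimately show ?thesis
    using F finite_subset by (simp add: schur_sum_def) blast
qed

definition schur_one :: "nat \<Rightarrow> nat \<Rightarrow> 'k::{comm_ring, comm_monoid_mult} endo" where
  "schur_one n = (\<lambda>q. if q = 0 then scalar_endo n 1 else 0)"

lemma schur_one_in_schur_sum: "schur_one n \<in> schur_sum n"
proof -
  have "{q. (schur_one n :: nat \<Rightarrow> 'a endo) q \<noteq> 0} \<subseteq> {0}"
    by (auto simp: schur_one_def)
  then show ?thesis
    using finite_subset by (auto simp: schur_sum_def schur_one_def zero_in_schur) (simp add: schur_def)
qed

lemma total_coeff_one:
  assumes "finite A"
  shows "total_coeff (schur_one n) A u w = (if A = {} then 1 else 0)"
  using assms by (simp add: total_coeff_def schur_one_def block_coeff_scalar_endo block_coeff_zero)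

definition schur_mult ::
    "nat \<Rightarrow> (nat \<Rightarrow> nat \<Rightarrow> (nat \<Rightarrow> nat) set) \<Rightarrow> (nat \<Rightarrow> 'k endo) \<Rightarrow> (nat \<Rightarrow> 'k endo) \<Rightarrow>
      nat \<Rightarrow> 'k::{comm_ring, comm_monoid_mult} endo" where
  "schur_mult n L F G = (\<lambda>q. \<Sum>a\<le>q. boxtimes n L a (q - a) (F a) (G (q - a)))"

lemma schur_algebra_simps:
  "carrier (schur_algebra n L) = schur_sum n"
  "monoid.mult (schur_algebra n L) = schur_mult n L"
  "one (schur_algebra n L) = schur_one n"
  "zero (schur_algebra n L) = 0"
  "add (schur_algebra n L) = (+)"
  "smult (schur_algebra n L) = schur_scale"
  by (simp_all add: schur_algebra_def schur_mult_def schur_one_def schur_scale_def fun_eq_iff)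

lemma cring_base_ring: "cring (base_ring :: 'k::{comm_ring, comm_monoid_mult} ring)"
proof (rule cringI)
  show "abelian_group (base_ring :: 'k ring)"
    by (rule abelian_groupI) (auto simp: base_ring_def add_ac intro: exI[of _ "- x" for x])
  show "comm_monoid (base_ring :: 'k ring)"
    by (rule comm_monoidI) (auto simp: base_ring_def mult_ac)
qed (simp add: base_ring_def distrib_right)

text \<open>Only degree \<open>2 * q\<close> may have a nonzero entry at \<open>q\<close>, so
  evaluation at \<open>q\<close> leaves one summand.\<close>

lemma sum_homogeneous:
  assumes c: "\<And>d. c d \<in> schur_degree n d" and fin: "finite {d. c d \<noteq> 0}"
  shows "(\<Sum>d\<in>{d. c d \<noteq> 0}. c d) q = c (2 * q) q"
proof -
  have "(\<Sum>d\<in>{d. c d \<noteq> 0}. c d) q = (\<Sum>d\<in>{d. c d \<noteq> 0}. if d = 2 * q then c (2 * q) q else 0)"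
    unfolding sum_fun_apply[of c _ q] by (intro sum.cong refl) (use c in \<open>auto simp: schur_degree_def\<close>)
  \<comment> \<open>If \<open>c (2 * q)\<close> vanishes, its index is missing from the sum, but
    then the right side is 0 too.\<close>
  also have "\<dots> = c (2 * q) q"
    using fin by simp
  finally show ?thesis .
qed

section \<open>Ring laws\<close>

context
  fixes n :: nat and L :: "nat \<Rightarrow> nat \<Rightarrow> (nat \<Rightarrow> nat) set"
  assumes L: "\<And>a b. a \<ge> 1 \<Longrightarrow> b \<ge> 1 \<Longrightarrow> left_coset_reps a b (L a b)"
begin

lemma boxtimes_zero:
  assumes "f \<in> schur a n" "g \<in> schur b n" "f = 0 \<or> g = 0"
  shows "boxtimes n L a b f g = 0"
proof (rule schur_eqI[OF boxtimes_in_schur[of a b L, OF L assms(1,2)] zero_in_schur])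
  show "boxtimes n L a b f g (basis_tensor u) w = 0 (basis_tensor u) w"
    if "u \<in> words n (a + b)" "w \<in> words n (a + b)" for u w
    using assms(3) boxtimes_basis_tensor[of a b L, OF L assms(1,2) that]
    by (auto simp: block_conv_def block_coeff_zero simp del: zero_fun_apply) simp_all
qed

text \<open>Controls the support of a product; both its finiteness and the additivity of degrees
  rest on this.\<close>

lemma schur_mult_nonzero:
  assumes F: "F \<in> schur_sum n" and G: "G \<in> schur_sum n" and "schur_mult n L F G q \<noteq> 0"
  shows "\<exists>a\<le>q. F a \<noteq> 0 \<and> G (q - a) \<noteq> 0"
proof (rule ccontr)
  assume "\<not> ?thesis"
  then have "schur_mult n L F G q = (\<Sum>a\<le>q. 0)"
    unfolding schur_mult_def
    by (intro sum.cong refl boxtimes_zero schur_sumD F G) auto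
  then show False using assms(3) by simp
qed

lemma schur_mult_in_schur_sum:
  assumes F: "F \<in> schur_sum n" and G: "G \<in> schur_sum n"
  shows "schur_mult n L F G \<in> schur_sum n"
proof -
  have "boxtimes n L a (q - a) (F a) (G (q - a)) \<in> schur q n" if "a \<le> q" for a q
    using boxtimes_in_schur[of a "q - a" L, OF L schur_sumD[OF F] schur_sumD[OF G]] that by simp
  then have "schur_mult n L F G q \<in> schur q n" for q
    unfolding schur_mult_def by (intro sum_in_schur) simp
  moreover have "{q. schur_mult n L F G q \<noteq> 0} \<subseteq> (\<lambda>(a, b). a + b) ` ({a. F a \<noteq> 0} \<times> {b. G b \<noteq> 0})"
  proof
    fix q assume "q \<in> {q. schur_mult n L F G q \<noteq> 0}"
    then obtain a where "a \<le> q" "F a \<noteq> 0" "G (q - a) \<noteq> 0"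
      using schur_mult_nonzero[OF F G] by blast
    then show "q \<in> (\<lambda>(a, b). a + b) ` ({a. F a \<noteq> 0} \<times> {b. G b \<noteq> 0})"
      by (intro image_eqI[of _ _ "(a, q - a)"]) auto
  qed
  moreover have "finite {a. F a \<noteq> 0}" "finite {b. G b \<noteq> 0}"
    using F G by (auto simp: schur_sum_def)
  ultimately show ?thesis
    unfolding schur_sum_def using finite_subset finite_imageI finite_cartesian_product by blast
qed

text \<open>Grouping the subsets of \<open>Z\<close> by size merges the sum over splittings of the
  degree with the sums over subsets of fixed size. Multiplication thereby becomes plain convolution
  of set functions.\<close>

lemma total_coeff_mult:
  assumes F: "F \<in> schur_sum n" and G: "G \<in> schur_sum n" and Z: "finite Z"
    and u: "u \<in> Z \<rightarrow> {1..n}" and w: "w \<in> Z \<rightarrow> {1..n}"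
  shows "total_coeff (schur_mult n L F G) Z u w =
    (\<Sum>A\<in>Pow Z. total_coeff F A u w * total_coeff G (Z - A) u w)"
proof -
  have "total_coeff (schur_mult n L F G) Z u w =
      (\<Sum>a\<le>card Z. block_coeff (boxtimes n L a (card Z - a) (F a) (G (card Z - a))) Z u w)"
    by (simp add: total_coeff_def schur_mult_def block_coeff_sum)
  also have "\<dots> = (\<Sum>a\<le>card Z. \<Sum>A | A \<in> Pow Z \<and> card A = a. total_coeff F A u w * total_coeff G (Z - A) u w)"
  proof (rule sum.cong[OF refl])
    fix a assume a: "a \<in> {..card Z}"
    have "block_coeff (boxtimes n L a (card Z - a) (F a) (G (card Z - a))) Z u w =
        block_conv (F a) (G (card Z - a)) a Z u w"
      by (rule block_coeff_boxtimes[OF L schur_sumD[OF F] schur_sumD[OF G] Z _ u w]) (use a in auto)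
    also have "\<dots> = (\<Sum>A | A \<in> Pow Z \<and> card A = a. total_coeff F A u w * total_coeff G (Z - A) u w)"
      unfolding block_conv_def
    proof (rule sum.cong)
      fix A assume "A \<in> {A. A \<in> Pow Z \<and> card A = a}"
      then have A: "A \<subseteq> Z" "card A = a" by auto
      then have "card (Z - A) = card Z - a"
        using card_Diff_subset[of A Z] finite_subset[OF A(1) Z] by simp
      then show "block_coeff (F a) A u w * block_coeff (G (card Z - a)) (Z - A) u w =
          total_coeff F A u w * total_coeff G (Z - A) u w"
        by (simp add: total_coeff_def A(2))
    qed (auto simp: k_subsets_def)
    finally show "block_coeff (boxtimes n L a (card Z - a) (F a) (G (card Z - a))) Z u w = \<dots>" .
  qed
  also have "\<dots> = (\<Sum>A\<in>Pow Z. total_coeff F A u w * total_coeff G (Z - A) u w)"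
    using Z by (intro sum.group) (auto intro: card_mono)
  finally show ?thesis .
qed

lemma schur_mult_commute:
  assumes F: "F \<in> schur_sum n" and G: "G \<in> schur_sum n"
  shows "schur_mult n L F G = schur_mult n L G F"
  by (rule schur_sum_eqI[OF schur_mult_in_schur_sum[OF F G] schur_mult_in_schur_sum[OF G F]])
    (simp add: total_coeff_mult F G, rule subset_conv_commute)

lemma schur_mult_assoc:
  assumes F: "F \<in> schur_sum n" and G: "G \<in> schur_sum n" and H: "H \<in> schur_sum n"
  shows "schur_mult n L (schur_mult n L F G) H = schur_mult n L F (schur_mult n L G H)"
proof (rule schur_sum_eqI)
  fix Z :: "nat set" and u w :: "nat \<Rightarrow> nat"
  assume Z: "finite Z" and u: "u \<in> Z \<rightarrow> {1..n}" and w: "w \<in> Z \<rightarrow> {1..n}"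
  \<comment> \<open>Stated for all subsets of \<open>Z\<close>, because the inner products are
    evaluated there.\<close>
  have coeff: "total_coeff (schur_mult n L X Y) A u w =
      (\<Sum>B\<in>Pow A. total_coeff X B u w * total_coeff Y (A - B) u w)"
    if "X \<in> schur_sum n" "Y \<in> schur_sum n" "A \<subseteq> Z" for X Y :: "nat \<Rightarrow> 'a endo" and A
    by (rule total_coeff_mult[OF that(1,2)]) (use that(3) Z u w finite_subset in auto)
  show "total_coeff (schur_mult n L (schur_mult n L F G) H) Z u w =
      total_coeff (schur_mult n L F (schur_mult n L G H)) Z u w"
    using subset_conv_assoc[OF Z, of "\<lambda>A. total_coeff F A u w" "\<lambda>A. total_coeff G A u w" "\<lambda>A. total_coeff H A u w"]
    by (simp add: coeff F G H schur_mult_in_schur_sum)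
qed (intro schur_mult_in_schur_sum F G H)+

lemma schur_mult_add_left:
  assumes F: "F \<in> schur_sum n" and G: "G \<in> schur_sum n" and H: "H \<in> schur_sum n"
  shows "schur_mult n L (F + G) H = schur_mult n L F H + schur_mult n L G H"
  by (rule schur_sum_eqI[where n = n])
    (simp_all add: F G H total_coeff_mult total_coeff_add schur_mult_in_schur_sum schur_sum_add
      distrib_right sum.distrib del: plus_fun_apply)

lemma schur_mult_scale_left:
  assumes F: "F \<in> schur_sum n" and G: "G \<in> schur_sum n"
  shows "schur_mult n L (schur_scale c F) G = schur_scale c (schur_mult n L F G)"
  by (rule schur_sum_eqI[where n = n])
    (simp_all add: F G total_coeff_mult total_coeff_scale schur_mult_in_schur_sum schur_sum_scale
      sum_distrib_left mult.assoc)

text \<open>By \<open>total_coeff_one\<close> the unit is the indicator of the empty set, which is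
  neutral for convolution.\<close>

lemma schur_mult_one_left:
  assumes F: "F \<in> schur_sum n"
  shows "schur_mult n L (schur_one n) F = F"
proof (rule schur_sum_eqI)
  fix Z :: "nat set" and u w :: "nat \<Rightarrow> nat"
  assume Z: "finite Z" and u: "u \<in> Z \<rightarrow> {1..n}" and w: "w \<in> Z \<rightarrow> {1..n}"
  have "total_coeff (schur_mult n L (schur_one n) F) Z u w =
      (\<Sum>A\<in>Pow Z. if A = {} then total_coeff F Z u w else 0)"
    unfolding total_coeff_mult[OF schur_one_in_schur_sum F Z u w]
    using finite_subset[OF _ Z] by (intro sum.cong) (simp_all add: total_coeff_one)
  also have "\<dots> = total_coeff F Z u w"
    using Z by simp
  finally show "total_coeff (schur_mult n L (schur_one n) F) Z u w = total_coeff F Z u w" .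
qed (intro schur_mult_in_schur_sum schur_one_in_schur_sum F)+

section \<open>Algebra structure and grading\<close>

lemma cring_schur_algebra: "cring (schur_algebra n L :: ('k::{comm_ring, comm_monoid_mult}, _) module)"
proof (rule cringI)
  show "abelian_group (schur_algebra n L :: ('k, _) module)"
  proof (rule abelian_groupI)
    fix x :: "nat \<Rightarrow> 'k endo" assume "x \<in> carrier (schur_algebra n L)"
    then show "\<exists>y\<in>carrier (schur_algebra n L). y \<oplus>\<^bsub>schur_algebra n L\<^esub> x = \<zero>\<^bsub>schur_algebra n L\<^esub>"
      unfolding schur_algebra_simps using schur_sum_scale schur_scale_minus_one by blast
  qed (simp_all add: schur_algebra_simps schur_sum_zero schur_sum_add add_ac del: zero_fun_apply plus_fun_apply)
  show "comm_monoid (schur_algebra n L :: ('k, _) module)"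
    by (rule comm_monoidI; unfold schur_algebra_simps)
      (intro schur_mult_in_schur_sum schur_one_in_schur_sum schur_mult_assoc schur_mult_one_left
        schur_mult_commute; assumption)+
qed (simp add: schur_algebra_simps schur_mult_add_left)

lemma algebra_schur_algebra:
  "algebra base_ring (schur_algebra n L :: ('k::{comm_ring, comm_monoid_mult}, _) module)"
proof (rule algebraI[OF cring_base_ring cring_schur_algebra])
qed (simp_all add: schur_algebra_simps schur_sum_scale schur_mult_scale_left,
    simp_all add: base_ring_def schur_scale_def scale_endo_def scale_tensor_def fun_eq_iff
      distrib_left distrib_right mult.assoc)

text \<open>Replaces the sum of the algebraic structure by the sum of functions, which can be
  evaluated degree by degree.\<close>

lemma finsum_schur_algebra:
  assumes "finite I" "\<And>i. i \<in> I \<Longrightarrow> c i \<in> schur_sum n"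
  shows "finsum (schur_algebra n L) c I = sum c I"
proof -
  interpret cring "schur_algebra n L" by (rule cring_schur_algebra)
  show ?thesis
    using assms
  proof (induction I)
    case (insert i I)
    then have "finsum (schur_algebra n L) c (insert i I) = c i + finsum (schur_algebra n L) c I"
      by (subst finsum_insert) (auto simp: schur_algebra_simps)
    with insert show ?case by (simp del: plus_fun_apply)
  qed (simp add: schur_algebra_simps)
qed

lemma graded_schur_algebra:
  "graded_by base_ring (schur_algebra n L :: ('k::{comm_ring, comm_monoid_mult}, _) module) (schur_degree n)"
  unfolding graded_by_def
proof (intro conjI allI ballI)
  let ?S = "schur_algebra n L :: ('k, _) module"
  interpret algebra base_ring ?S by (rule algebra_schur_algebra)
  fix d
  show "submodule (schur_degree n d) base_ring ?S"
  proof (rule submoduleI)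
    fix x :: "nat \<Rightarrow> 'k endo" assume x: "x \<in> schur_degree n d"
    then have S: "x \<in> schur_sum n" by (simp add: schur_degree_def)
    have "\<ominus>\<^bsub>?S\<^esub> x = schur_scale (- 1) x"
      by (rule M.minus_equality)
        (use S schur_scale_minus_one schur_sum_scale in \<open>simp_all add: schur_algebra_simps del: plus_fun_apply\<close>)
    then show "\<ominus>\<^bsub>?S\<^esub> x \<in> schur_degree n d"
      using x schur_sum_scale[OF S, of "- 1"] by (simp add: schur_degree_def schur_scale_def scale_endo_zero)
  next
    fix x y :: "nat \<Rightarrow> 'k endo" assume "x \<in> schur_degree n d" "y \<in> schur_degree n d"
    then show "x \<oplus>\<^bsub>?S\<^esub> y \<in> schur_degree n d"
      using schur_sum_add[of x n y] by (simp add: schur_algebra_simps schur_degree_def)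
  next
    fix c and x :: "nat \<Rightarrow> 'k endo" assume "x \<in> schur_degree n d"
    then show "c \<odot>\<^bsub>?S\<^esub> x \<in> schur_degree n d"
      using schur_sum_scale[of x n c] by (simp add: schur_algebra_simps schur_degree_def schur_scale_def scale_endo_zero)
  qed (auto simp: schur_algebra_simps schur_degree_def schur_sum_zero)
next
  let ?S = "schur_algebra n L :: ('k, _) module"
  fix x assume "x \<in> carrier ?S"
  then have x: "x \<in> schur_sum n" by (simp add: schur_algebra_simps)
  \<comment> \<open>A homogeneous decomposition is reduced to a condition on entries; existence and
    uniqueness are both read off from it.\<close>
  have decomp: "x = (\<Oplus>\<^bsub>?S\<^esub>d\<in>{d. c d \<noteq> \<zero>\<^bsub>?S\<^esub>}. c d) \<longleftrightarrow> (\<forall>q. x q = c (2 * q) q)"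
    if c: "\<forall>d. c d \<in> schur_degree n d" and fin: "finite {d. c d \<noteq> \<zero>\<^bsub>?S\<^esub>}" for c
  proof -
    have "(\<Oplus>\<^bsub>?S\<^esub>d\<in>{d. c d \<noteq> \<zero>\<^bsub>?S\<^esub>}. c d) = sum c {d. c d \<noteq> 0}"
      using finsum_schur_algebra[OF fin, of c] c by (simp add: schur_algebra_simps schur_degree_def)
    then show ?thesis
      using sum_homogeneous[of c n] c fin by (simp add: schur_algebra_simps fun_eq_iff[of x])
  qed
  \<comment> \<open>The entry \<open>x q\<close> alone, placed in degree \<open>2 * q\<close>; all
    odd components are 0.\<close>
  define c where "c d = (\<lambda>q. if 2 * q = d then x q else 0)" for d
  have c_nonzero: "{d. c d \<noteq> 0} \<subseteq> (*) 2 ` {q. x q \<noteq> 0}"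
    by (auto simp: c_def fun_eq_iff[where f = "\<lambda>q. if 2 * q = _ then x q else 0"])
  have fin_x: "finite {q. x q \<noteq> 0}" using x by (simp add: schur_sum_def)
  have "{q. c d q \<noteq> 0} \<subseteq> {q. x q \<noteq> 0}" for d by (auto simp: c_def)
  then have "finite {q. c d q \<noteq> 0}" for d using fin_x finite_subset by blast
  moreover have "c d q \<in> schur q n" for d q
    using schur_sumD[OF x] by (simp add: c_def zero_in_schur)
  ultimately have c: "\<forall>d. c d \<in> schur_degree n d"
    by (simp add: schur_degree_def schur_sum_def) (simp add: c_def)
  have fin: "finite {d. c d \<noteq> \<zero>\<^bsub>?S\<^esub>}"
    using finite_subset[OF c_nonzero] fin_x by (simp add: schur_algebra_simps)
  show "\<exists>!c. (\<forall>d. c d \<in> schur_degree n d) \<and> finite {d. c d \<noteq> \<zero>\<^bsub>?S\<^esub>} \<and>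
      x = (\<Oplus>\<^bsub>?S\<^esub>d\<in>{d. c d \<noteq> \<zero>\<^bsub>?S\<^esub>}. c d)"
  proof (rule ex1I[of _ c])
    show "(\<forall>d. c d \<in> schur_degree n d) \<and> finite {d. c d \<noteq> \<zero>\<^bsub>?S\<^esub>} \<and>
        x = (\<Oplus>\<^bsub>?S\<^esub>d\<in>{d. c d \<noteq> \<zero>\<^bsub>?S\<^esub>}. c d)"
      using c fin decomp[OF c fin] by (simp add: c_def)
    fix c' assume c': "(\<forall>d. c' d \<in> schur_degree n d) \<and> finite {d. c' d \<noteq> \<zero>\<^bsub>?S\<^esub>} \<and>
        x = (\<Oplus>\<^bsub>?S\<^esub>d\<in>{d. c' d \<noteq> \<zero>\<^bsub>?S\<^esub>}. c' d)"
    then have "x q = c' (2 * q) q" for q using decomp[of c'] by blast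
    \<comment> \<open>Homogeneity settles the entries that the pointwise condition does not
      mention.\<close>
    moreover have "c' d q = 0" if "2 * q \<noteq> d" for d q using c' that by (auto simp: schur_degree_def)
    ultimately have "c' d q = c d q" for d q by (simp add: c_def)
    then show "c' = c" by blast
  qed
next
  show "\<one>\<^bsub>schur_algebra n L\<^esub> \<in> schur_degree n 0"
    by (simp add: schur_algebra_simps schur_degree_def schur_one_in_schur_sum) (simp add: schur_one_def)
next
  fix d e and x y :: "nat \<Rightarrow> 'k endo"
  assume x: "x \<in> schur_degree n d" and y: "y \<in> schur_degree n e"
  then have S: "x \<in> schur_sum n" "y \<in> schur_sum n" by (simp_all add: schur_degree_def)
  \<comment> \<open>A nonzero entry at \<open>q\<close> needs nonzero entries at some
    \<open>a \<le> q\<close> and at \<open>q - a\<close>, which force \<open>2 * a = d\<close> and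
    \<open>2 * (q - a) = e\<close>.\<close>
  have "2 * q = d + e" if nz: "schur_mult n L x y q \<noteq> 0" for q
  proof -
    obtain a where "a \<le> q" "x a \<noteq> 0" "y (q - a) \<noteq> 0"
      using schur_mult_nonzero[OF S nz] by blast
    moreover from this have "2 * a = d" "2 * (q - a) = e"
      using x y unfolding schur_degree_def by blast+
    ultimately show ?thesis by linarith
  qed
  then show "x \<otimes>\<^bsub>schur_algebra n L\<^esub> y \<in> schur_degree n (d + e)"
    using schur_mult_in_schur_sum[OF S] unfolding schur_algebra_simps schur_degree_def by blast
qed

text \<open>If \<open>d * e\<close> is even, the sign is 1 and commutativity suffices. If it is odd,
  then \<open>d\<close> is odd, and components of odd degree are zero.\<close>

lemma anti_commutative_schur_algebra:
  "anti_commutative base_ring (schur_algebra n L :: ('k::{comm_ring, comm_monoid_mult}, _) module) (schur_degree n)"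
  unfolding anti_commutative_def
proof (intro allI ballI)
  let ?S = "schur_algebra n L :: ('k, _) module"
  let ?R = "base_ring :: 'k ring"
  interpret algebra ?R ?S by (rule algebra_schur_algebra)
  fix d e and x y :: "nat \<Rightarrow> 'k endo"
  assume x: "x \<in> schur_degree n d" and y: "y \<in> schur_degree n e"
  then have S: "x \<in> carrier ?S" "y \<in> carrier ?S" by (simp_all add: schur_degree_def schur_algebra_simps)
  have odd: "z = \<zero>\<^bsub>?S\<^esub>" if "z \<in> schur_degree n m" "odd m" for z m
  proof
    show "z q = \<zero>\<^bsub>?S\<^esub> q" for q
      using that by (auto simp: schur_degree_def schur_algebra_simps)
  qed
  show "x \<otimes>\<^bsub>?S\<^esub> y = ((\<ominus>\<^bsub>?R\<^esub> \<one>\<^bsub>?R\<^esub>) [^]\<^bsub>?R\<^esub> (d * e)) \<odot>\<^bsub>?S\<^esub> (y \<otimes>\<^bsub>?S\<^esub> x)"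
  proof (cases "even (d * e)")
    case True
    then obtain k where k: "d * e = 2 * k" by blast
    have "(\<ominus>\<^bsub>?R\<^esub> \<one>\<^bsub>?R\<^esub>) [^]\<^bsub>?R\<^esub> (2::nat) = \<one>\<^bsub>?R\<^esub>"
      by (simp add: numeral_2_eq_2 R.l_minus)
    then have "(\<ominus>\<^bsub>?R\<^esub> \<one>\<^bsub>?R\<^esub>) [^]\<^bsub>?R\<^esub> (d * e) = \<one>\<^bsub>?R\<^esub>"
      using R.nat_pow_pow[of "\<ominus>\<^bsub>?R\<^esub> \<one>\<^bsub>?R\<^esub>" 2 k] by (simp add: k)
    then show ?thesis
      using S by (simp add: m_comm[of y x])
  next
    case False
    then have "x = \<zero>\<^bsub>?S\<^esub>" using odd[OF x] by simp
    then show ?thesis using S by simp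
  qed
qed

end

theorem theorem5p6:
  fixes n :: nat
    and L :: "nat \<Rightarrow> nat \<Rightarrow> (nat \<Rightarrow> nat) set"
    and S :: "('k::{comm_ring, comm_monoid_mult}, nat \<Rightarrow> 'k endo) module" (structure)
  assumes "n \<ge> 1"
    and "\<And>a b. a \<ge> 1 \<Longrightarrow> b \<ge> 1 \<Longrightarrow> left_coset_reps a b (L a b)"
    and "S = schur_algebra n L"
  shows
    "(\<forall>x\<in>carrier S. \<forall>y\<in>carrier S. \<forall>z\<in>carrier S. (x \<otimes> y) \<otimes> z = x \<otimes> (y \<otimes> z)) \<and>
     (\<forall>x\<in>carrier S. \<forall>y\<in>carrier S. x \<otimes> y = y \<otimes> x) \<and>
     (\<forall>x\<in>carrier S. \<forall>y\<in>carrier S. \<forall>z\<in>carrier S.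
        x \<otimes> (y \<oplus> z) = x \<otimes> y \<oplus> x \<otimes> z \<and> (x \<oplus> y) \<otimes> z = x \<otimes> z \<oplus> y \<otimes> z) \<and>
     algebra base_ring S \<and>
     graded_by base_ring S (schur_degree n) \<and>
     anti_commutative base_ring S (schur_degree n)"
proof -
  note L = assms(2) and S = assms(3)
  \<comment> \<open>The associative, commutative and distributive laws are taken from the ring
    structure contained in this locale.\<close>
  interpret algebra base_ring S
    unfolding S by (rule algebra_schur_algebra[OF L])
  have "graded_by base_ring S (schur_degree n)" "anti_commutative base_ring S (schur_degree n)"
    unfolding S by (rule graded_schur_algebra[OF L] anti_commutative_schur_algebra[OF L]; assumption)+
  then show ?thesis
    by (auto simp: m_assoc l_distr r_distr algebra_axioms intro: m_comm)
qed

end
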